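(* Let $P(x)=\sum_{k=0}^K p_k x^k$, $p_K\neq 0$, be a polynomial with (complex) coefficients $p_k$, and let $h(t)=P(\ln t)\,t^{-1}$, $t>0$. Let $H$ be the Hankel operator $(Hf)(t)=\int_0^\infty h(t+s)f(s)\,ds$ in $L^2(\mathbb{R}_+)$. Let $Q(x)=\sum_{k=0}^K q_k x^k$ be the polynomial with coefficients $$q_k=\sum_{\ell=k}^K \binom{\ell}{k}\,\omega^{(\ell-k)}(0)\,p_\ell,\quad k=0,\ldots,K,\qquad \omega(z)=\Gamma(1-z)^{-1},$$ and let $A=vQ(D)v$ be the differential operator $(Ag)(\xi)=v(\xi)\,\big(Q(D)(vg)\big)(\xi)$ on $\mathbb{R}$, where $D=i\,d/d\xi$ and $v(\xi)=\sqrt{\pi}/\sqrt{\cosh(\pi\xi)}$. Then for all $f_1,f_2\in\mathcal{D}$ the identity $$(Hf_1,f_2)=(AFf_1,Ff_2)$$ holds, where the inner product on the left is that of $L^2(\mathbb{R}_+)$ and the one on the right is that of $L^2(\mathbb{R})$.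
   Context: Inner products are linear in the first argument and antilinear in the second. The Fourier transform is $(\Phi u)(\xi)=(2\pi)^{-1/2}\int_{-\infty}^\infty u(x)e^{-ix\xi}\,dx$. The unitary operator $U:L^2(\mathbb{R}_+)\to L^2(\mathbb{R})$ is $(Uf)(x)=e^{x/2}f(e^x)$, and $M=\Phi U$ is the Mellin transform. The unitary operator $F:L^2(\mathbb{R}_+)\to L^2(\mathbb{R})$ is $$(Ff)(\xi)=\frac{\Gamma(1/2+i\xi)}{|\Gamma(1/2+i\xi)|}(Mf)(\xi),$$ with $\Gamma$ the gamma function. The space $\mathcal{Z}$ is the subset of the Schwartz space $\mathcal{S}(\mathbb{R})$ consisting of functions $u$ admitting analytic continuation to entire functions on $\mathbb{C}$ and satisfying, for some $r=r(u)>0$ and all $n$, bounds $|u(z)|\le C_n(1+|z|)^{-n}e^{r|\operatorname{Im} z|}$, $z\in\mathbb{C}$. The set $\mathcal{D}\subset L^2(\mathbb{R}_+)$ consists of all $f$ with $Uf\in\mathcal{Z}$; for $f\in\mathcal{D}$ one has $Ff\in C_0^\infty(\mathbb{R})$. *)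

theory Defs
  imports "HOL-Complex_Analysis.Complex_Analysis"
begin

text \<open>
  Elements of \<open>L\<^sup>2(S)\<close> are represented by functions \<^typ>\<open>real \<Rightarrow> complex\<close>; values outside \<open>S\<close> are
  irrelevant.
\<close>

definition L2 :: "real set \<Rightarrow> (real \<Rightarrow> complex) set" where
  "L2 S = {f. set_borel_measurable lborel S f \<and> set_integrable lborel S (\<lambda>x. (cmod (f x))\<^sup>2)}"

definition L2_inner :: "real set \<Rightarrow> (real \<Rightarrow> complex) \<Rightarrow> (real \<Rightarrow> complex) \<Rightarrow> complex" where
  "L2_inner S f g = (LINT x:S|lborel. f x * cnj (g x))"

definition vderiv :: "(real \<Rightarrow> complex) \<Rightarrow> real \<Rightarrow> complex" where
  "vderiv u x = vector_derivative u (at x)"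

definition schwartz_space :: "(real \<Rightarrow> complex) set" where
  "schwartz_space = {u. (\<forall>k x. (vderiv ^^ k) u differentiable (at x)) \<and>
     (\<forall>m k. \<exists>C. \<forall>x. \<bar>x\<bar> ^ m * cmod ((vderiv ^^ k) u x) \<le> C)}"

definition Z_space :: "(real \<Rightarrow> complex) set" where
  "Z_space = {u \<in> schwartz_space. \<exists>w. w holomorphic_on UNIV \<and> (\<forall>x. w (of_real x) = u x) \<and>
     (\<exists>r>0. \<forall>n::nat. \<exists>C. \<forall>z. cmod (w z) \<le> C * inverse ((1 + cmod z) ^ n) * exp (r * \<bar>Im z\<bar>))}"

definition fourier :: "(real \<Rightarrow> complex) \<Rightarrow> real \<Rightarrow> complex" where
  "fourier u \<xi> = of_real ((2 * pi) powr (- 1 / 2)) *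
     (LINT x|lborel. u x * exp (- \<i> * of_real x * of_real \<xi>))"

definition U_op :: "(real \<Rightarrow> complex) \<Rightarrow> real \<Rightarrow> complex" where
  "U_op f x = of_real (exp (x / 2)) * f (exp x)"

definition mellin :: "(real \<Rightarrow> complex) \<Rightarrow> real \<Rightarrow> complex" where
  "mellin f = fourier (U_op f)"

definition F_op :: "(real \<Rightarrow> complex) \<Rightarrow> real \<Rightarrow> complex" where
  "F_op f \<xi> = Gamma (1 / 2 + \<i> * of_real \<xi>) / of_real (cmod (Gamma (1 / 2 + \<i> * of_real \<xi>)))
     * mellin f \<xi>"

text \<open>Membership of \<open>U f\<close> in \<open>\<Z>\<close> is meant for \<open>L\<^sup>2\<close>-classes, hence almost everywhere.\<close>

definition D_set :: "(real \<Rightarrow> complex) set" where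
  "D_set = {f \<in> L2 {0<..}. \<exists>u \<in> Z_space. AE x in lborel. U_op f x = u x}"

definition hankel :: "(real \<Rightarrow> complex) \<Rightarrow> (real \<Rightarrow> complex) \<Rightarrow> real \<Rightarrow> complex" where
  "hankel h f t = (LINT s:{0<..}|lborel. h (t + s) * f s)"

definition log_kernel :: "complex poly \<Rightarrow> real \<Rightarrow> complex" where
  "log_kernel P t = poly P (of_real (ln t)) / of_real t"

definition omega :: "complex \<Rightarrow> complex" where
  "omega z = inverse (Gamma (1 - z))"

definition Q_coeff :: "complex poly \<Rightarrow> nat \<Rightarrow> complex" where
  "Q_coeff P k = (\<Sum>l=k..degree P. of_nat (l choose k) * (deriv ^^ (l - k)) omega 0 * coeff P l)"

definition Q_poly :: "complex poly \<Rightarrow> complex poly" where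
  "Q_poly P = (\<Sum>k=0..degree P. monom (Q_coeff P k) k)"

definition D_op :: "(real \<Rightarrow> complex) \<Rightarrow> real \<Rightarrow> complex" where
  "D_op g \<xi> = \<i> * vderiv g \<xi>"

definition poly_D :: "complex poly \<Rightarrow> (real \<Rightarrow> complex) \<Rightarrow> real \<Rightarrow> complex" where
  "poly_D Q g \<xi> = (\<Sum>k=0..degree Q. coeff Q k * (D_op ^^ k) g \<xi>)"

definition v_fun :: "real \<Rightarrow> real" where
  "v_fun \<xi> = sqrt pi / sqrt (cosh (pi * \<xi>))"

definition A_op :: "complex poly \<Rightarrow> (real \<Rightarrow> complex) \<Rightarrow> real \<Rightarrow> complex" where
  "A_op Q g \<xi> = of_real (v_fun \<xi>) * poly_D Q (\<lambda>x. of_real (v_fun x) * g x) \<xi>"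

end

theory Submission
  imports Defs "HOL-Probability.Characteristic_Functions" "HOL-Probability.Sinc_Integral"
begin

text \<open>
  The Laplace transform \<open>L\<close> diagonalizes the Hankel form. Differentiate the integral
  \<open>\<Gamma>(1 - s) \<tau>\<^bsup>s - 1\<^esup> = \<integral> \<lambda>\<^bsup>-s\<^esup> e\<^bsup>-\<tau> \<lambda>\<^esup> d\<lambda>\<close> over \<open>\<lambda> > 0\<close> in \<open>s\<close>, at \<open>s = 0\<close>. The coefficients of \<open>Q\<close>
  are made so that Leibniz' rule gives \<open>P(ln \<tau>) / \<tau> = \<integral> Q(- ln \<lambda>) e\<^bsup>-\<tau> \<lambda>\<^esup> d\<lambda>\<close> (lemma \<open>log_kernel_laplace\<close>).
  With \<open>\<tau> = t + s\<close> the exponential factorizes, so the Hankel form becomes diagonal: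
  \<open>(H f\<^sub>1, f\<^sub>2) = \<integral> Q(- ln \<lambda>) (L f\<^sub>1)(\<lambda>) cnj ((L f\<^sub>2)(\<lambda>)) d\<lambda>\<close>.

  In exponential coordinates \<open>t = e\<^sup>x\<close>, \<open>\<lambda> = e\<^bsup>-z\<^esup>\<close>, with \<open>u = U f\<close>, the function
  \<open>w(z) = e\<^bsup>-z/2\<^esup> (L f)(e\<^bsup>-z\<^esup>)\<close> is the convolution of \<open>u\<close> with the reflection
  of \<open>e\<^bsup>x/2\<^esup> exp (-e\<^sup>x)\<close>. The form is then
  \<open>\<integral> Q(z) w\<^sub>1(z) cnj (w\<^sub>2(z)) dz\<close> (lemma \<open>hankel_form_diagonal\<close>). The Fourier transform of \<open>w\<close> is
  \<open>\<Gamma>(1/2 + i \<xi>)\<close> times that of \<open>u\<close> (lemma \<open>fourier_gamma_conv\<close>). By the reflection formula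
  \<open>\<bar>\<Gamma>(1/2 + i \<xi>)\<bar> = v(\<xi>)\<close>, so this Fourier transform is exactly \<open>v F f\<close> (lemma \<open>v_mult_F_op\<close>).
  The Fourier transform turns multiplication by \<open>Q(z)\<close> into \<open>Q(D)\<close> (lemma \<open>poly_D_fourier\<close>), and
  Parseval's identity gives \<open>\<integral> Q(D) (v F f\<^sub>1) cnj (v F f\<^sub>2) d\<xi> = (A F f\<^sub>1, F f\<^sub>2)\<close>.

  Convergence is never delicate: \<open>U f\<close> is continuous and decays faster than any power, the kernel
  decays exponentially, and \<open>v\<close> supplies exponential decay on the Fourier side.
\<close>

section \<open>Rapidly decreasing functions\<close>

text \<open>
  This class contains the Schwartz space, and also double exponentials such as \<open>e\<^bsup>x/2\<^esup> exp (-e\<^sup>x)\<close>,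
  for which a pointwise bound by \<open>e\<^bsup>-\<bar>x\<bar>/2\<^esup>\<close> proves membership. So one lemma provides all moments
  that the Fourier and convolution arguments use.
\<close>

definition rapidly_decreasing :: "(real \<Rightarrow> complex) \<Rightarrow> bool" where
  "rapidly_decreasing u \<longleftrightarrow>
     continuous_on UNIV u \<and> (\<forall>m::nat. \<exists>C. \<forall>x. \<bar>x\<bar> ^ m * cmod (u x) \<le> C)"

lemma rapidly_decreasing_measurable:
  "rapidly_decreasing u \<Longrightarrow> u \<in> borel_measurable borel"
  by (auto simp: rapidly_decreasing_def intro: borel_measurable_continuous_onI)

text \<open>
  Multiplication by \<open>1 + x\<^sup>2\<close> raises the weight by two powers and still leaves a bounded function;
  so \<open>1 / (1 + x\<^sup>2)\<close> is an integrable majorant, up to a constant.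
\<close>

lemma rapidly_decreasing_weight_integrable:
  assumes "rapidly_decreasing u"
  shows "integrable lborel (\<lambda>x. (1 + \<bar>x\<bar>) ^ n * cmod (u x))"
proof -
  have [measurable]: "u \<in> borel_measurable borel"
    by (rule rapidly_decreasing_measurable[OF assms])
  obtain C0 where C0: "\<And>x. \<bar>x\<bar> ^ 0 * cmod (u x) \<le> C0"
    using assms unfolding rapidly_decreasing_def by blast
  obtain C1 where C1: "\<And>x. \<bar>x\<bar> ^ (n + 2) * cmod (u x) \<le> C1"
    using assms unfolding rapidly_decreasing_def by blast
  have pow: "(1 + a) ^ m \<le> 2 ^ m * (1 + a ^ m)" if "a \<ge> 0" for a :: real and m :: nat
  proof -
    have "(1 + a) ^ m \<le> (2 * max 1 a) ^ m"
      using that by (intro power_mono) auto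
    also have "\<dots> \<le> 2 ^ m * (1 + a ^ m)"
      using that by (auto simp: power_mult_distrib max_def)
    finally show ?thesis .
  qed
  have bound: "(1 + \<bar>x\<bar>) ^ n * cmod (u x) \<le> 2 ^ (n + 2) * (C0 + C1) * inverse (1 + x\<^sup>2)" for x
  proof -
    have "1 + x\<^sup>2 \<le> (1 + \<bar>x\<bar>) ^ 2"
      by (simp add: power2_eq_square algebra_simps)
    then have "(1 + \<bar>x\<bar>) ^ n * cmod (u x) * (1 + x\<^sup>2) \<le> (1 + \<bar>x\<bar>) ^ n * cmod (u x) * (1 + \<bar>x\<bar>) ^ 2"
      by (intro mult_left_mono) auto
    also have "\<dots> = (1 + \<bar>x\<bar>) ^ (n + 2) * cmod (u x)"
      by (simp only: power_add ac_simps)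
    also have "\<dots> \<le> 2 ^ (n + 2) * (1 + \<bar>x\<bar> ^ (n + 2)) * cmod (u x)"
      by (intro mult_right_mono pow) auto
    also have "\<dots> = 2 ^ (n + 2) * (\<bar>x\<bar> ^ 0 * cmod (u x) + \<bar>x\<bar> ^ (n + 2) * cmod (u x))"
      by (simp only: power_0 ring_distribs mult_1 mult.assoc)
    also have "\<dots> \<le> 2 ^ (n + 2) * (C0 + C1)"
      by (intro mult_left_mono add_mono C0 C1) auto
    finally have "(1 + \<bar>x\<bar>) ^ n * cmod (u x) * (1 + x\<^sup>2) \<le> 2 ^ (n + 2) * (C0 + C1)" .
    moreover have "1 + x\<^sup>2 > 0"
      by (rule add_pos_nonneg) auto
    ultimately show ?thesis
      by (simp add: field_simps)
  qed
  have int: "integrable lborel (\<lambda>x::real. inverse (1 + x\<^sup>2))"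
    using integrable_inverse_1_plus_square by (simp add: set_integrable_def)
  show ?thesis
  proof (rule Bochner_Integration.integrable_bound)
    show "integrable lborel (\<lambda>x::real. 2 ^ (n + 2) * (C0 + C1) * inverse (1 + x\<^sup>2))"
      by (intro integrable_mult_right int)
    show "AE x in lborel. norm ((1 + \<bar>x\<bar>) ^ n * cmod (u x))
            \<le> norm (2 ^ (n + 2) * (C0 + C1) * inverse (1 + x\<^sup>2))"
      using order_trans[OF bound abs_ge_self] by (intro AE_I2) simp
  qed measurable
qed

lemma rapidly_decreasing_moment_integrable:
  assumes "rapidly_decreasing u"
  shows "integrable lborel (\<lambda>x. of_real x ^ n * u x)"
proof (rule Bochner_Integration.integrable_bound[OF rapidly_decreasing_weight_integrable[OF assms]])
  have [measurable]: "u \<in> borel_measurable borel"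
    by (rule rapidly_decreasing_measurable[OF assms])
  show "(\<lambda>x. of_real x ^ n * u x) \<in> borel_measurable lborel"
    by measurable
  show "AE x in lborel. norm (of_real x ^ n * u x) \<le> norm ((1 + \<bar>x\<bar>) ^ n * cmod (u x))"
    by (auto simp: norm_mult norm_power intro!: mult_right_mono power_mono)
qed

lemma rapidly_decreasing_integrable:
  "rapidly_decreasing u \<Longrightarrow> integrable lborel u"
  using rapidly_decreasing_moment_integrable[of u 0] by simp

lemma Z_space_rapidly_decreasing:
  assumes "u \<in> Z_space"
  shows "rapidly_decreasing u"
proof -
  have S: "(vderiv ^^ 0) u differentiable (at x)"
    "\<exists>C. \<forall>x. \<bar>x\<bar> ^ m * cmod ((vderiv ^^ 0) u x) \<le> C" for m x
    using assms unfolding Z_space_def schwartz_space_def by blast+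
  have "continuous_on UNIV u"
    using S(1) by (intro continuous_at_imp_continuous_on ballI differentiable_imp_continuous_within) simp
  then show ?thesis
    using S(2) by (simp add: rapidly_decreasing_def)
qed

section \<open>Exponential coordinates and the Gamma kernel\<close>

text \<open>
  This is \<open>U\<close> applied to \<open>e\<^bsup>-t\<^esup>\<close>. Its inverse Fourier transform is, up to a constant, the Gamma
  function on the line \<open>Re s = 1/2\<close>.
\<close>

definition gamma_kernel :: "real \<Rightarrow> real" where
  "gamma_kernel x = exp (x / 2 - exp x)"

text \<open>
  For positive \<open>x\<close> the quadratic term of \<open>e\<^sup>x\<close> wins. The one bound serves both ends of the line:
  it shows that \<open>e\<^bsup>x\<^esup> exp (-e\<^sup>x)\<close> decays exponentially in both directions.
\<close>

lemma sub_exp_le: "x - exp x \<le> - \<bar>x\<bar> / 2" for x :: real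
proof (cases "x \<ge> 0")
  case True
  have "0 \<le> (x - 1 / 2)\<^sup>2" by simp
  then have "x / 2 \<le> 1 + x\<^sup>2 / 2"
    by (simp add: power2_eq_square field_simps)
  then show ?thesis
    using exp_lower_Taylor_quadratic[OF True] True by simp
next
  case False
  then have "x - exp x \<le> x" "- \<bar>x\<bar> / 2 = x / 2" by auto
  then show ?thesis using False by linarith
qed

text \<open>
  Compare with a single term of the exponential series, at \<open>\<bar>x\<bar> / 2\<close>.
\<close>

lemma power_mult_exp_bounded:
  fixes x :: real
  shows "\<bar>x\<bar> ^ m * exp (- \<bar>x\<bar> / 2) \<le> 2 ^ m * fact m"
proof -
  define y where "y = \<bar>x\<bar> / 2"
  have "(\<Sum>n\<in>{m}. y ^ n /\<^sub>R fact n) \<le> exp y"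
    unfolding exp_def using summable_exp_generic[of y]
    by (intro sum_le_suminf) (auto simp: y_def)
  then have "y ^ m \<le> fact m * exp y"
    by (simp add: field_simps)
  then have "\<bar>x\<bar> ^ m \<le> 2 ^ m * fact m * exp y"
    by (simp add: y_def power_divide field_simps)
  then show ?thesis
    by (simp add: y_def exp_minus field_simps)
qed

lemma rapidly_decreasing_if_exp_bounded:
  assumes "continuous_on UNIV a" and bound: "\<And>x. cmod (a x) \<le> C * exp (- \<bar>x\<bar> / 2)"
  shows "rapidly_decreasing a"
  unfolding rapidly_decreasing_def
proof (intro conjI allI exI)
  fix m :: nat and x :: real
  have "C \<ge> 0"
    using order_trans[OF norm_ge_zero bound[of 0]] by simp
  have "\<bar>x\<bar> ^ m * cmod (a x) \<le> \<bar>x\<bar> ^ m * (C * exp (- \<bar>x\<bar> / 2))"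
    by (intro mult_left_mono bound) auto
  also have "\<dots> = C * (\<bar>x\<bar> ^ m * exp (- \<bar>x\<bar> / 2))"
    by (simp only: ac_simps)
  also have "\<dots> \<le> C * (2 ^ m * fact m)"
    by (intro mult_left_mono power_mult_exp_bounded \<open>C \<ge> 0\<close>)
  finally show "\<bar>x\<bar> ^ m * cmod (a x) \<le> C * (2 ^ m * fact m)" .
qed fact

lemma gamma_kernel_pos: "gamma_kernel x > 0"
  by (simp add: gamma_kernel_def)

lemma gamma_kernel_le_exp: "gamma_kernel x \<le> exp (- \<bar>x\<bar> / 2)"
proof -
  have "x / 2 - exp x \<le> - \<bar>x\<bar> / 2"
  proof (cases "x \<ge> 0")
    case False
    have "x / 2 - exp x \<le> x / 2" by simp
    then show ?thesis using False by simp
  qed (use sub_exp_le[of x] in simp)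
  then show ?thesis
    by (simp add: gamma_kernel_def)
qed

lemma gamma_kernel_le_1: "gamma_kernel x \<le> 1"
  by (rule order_trans[OF gamma_kernel_le_exp]) simp

lemma continuous_on_gamma_kernel [continuous_intros]:
  "continuous_on A f \<Longrightarrow> continuous_on A (\<lambda>x. gamma_kernel (f x))"
  unfolding gamma_kernel_def by (intro continuous_intros) auto

lemma gamma_kernel_measurable [measurable]: "gamma_kernel \<in> borel_measurable borel"
  unfolding gamma_kernel_def by measurable

lemma rapidly_decreasing_gamma_kernel: "rapidly_decreasing (\<lambda>x. of_real (gamma_kernel x))"
  using gamma_kernel_le_exp gamma_kernel_pos
  by (intro rapidly_decreasing_if_exp_bounded[where C = 1] continuous_intros)
     (auto simp: abs_of_pos)

text \<open>
  The substitution \<open>z = ln \<tau> - x\<close> turns the exponent into \<open>x - e\<^sup>x - ln \<tau>\<close>, to which the bound on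
  \<open>x - e\<^sup>x\<close> applies.
\<close>

lemma rapidly_decreasing_double_exp:
  assumes "\<tau> > 0"
  shows "rapidly_decreasing (\<lambda>z. of_real (exp (- z - \<tau> * exp (- z))))"
proof (rule rapidly_decreasing_if_exp_bounded[where C = "exp (\<bar>ln \<tau>\<bar> / 2 - ln \<tau>)"])
  fix z :: real
  have "\<tau> * exp (- z) = exp (ln \<tau> - z)"
    using assms by (simp add: exp_diff exp_minus field_simps)
  moreover have "\<bar>z\<bar> \<le> \<bar>ln \<tau>\<bar> + \<bar>ln \<tau> - z\<bar>"
    by arith
  ultimately have "- z - \<tau> * exp (- z) \<le> \<bar>ln \<tau>\<bar> / 2 - ln \<tau> + - \<bar>z\<bar> / 2"
    using sub_exp_le[of "ln \<tau> - z"] by (simp add: field_simps)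
  then show "cmod (of_real (exp (- z - \<tau> * exp (- z))))
      \<le> exp (\<bar>ln \<tau>\<bar> / 2 - ln \<tau>) * exp (- \<bar>z\<bar> / 2)"
    by (simp flip: exp_add)
qed (intro continuous_intros)

lemma range_exp_real: "range exp = {0 :: real<..}"
  by (auto simp: image_iff) (metis exp_ln)

text \<open>
  Euler's integral in the variable \<open>x = ln t\<close>.
\<close>

lemma Gamma_exp_integral:
  assumes s: "Re s > 0"
  shows "integrable lborel (\<lambda>x. exp (s * of_real x - of_real (exp x)))"
    and "(LINT x|lborel. exp (s * of_real x - of_real (exp x))) = Gamma s"
proof -
  let ?f = "\<lambda>t. complex_of_real t powr (s - 1) / of_real (exp t)"
  let ?g = "\<lambda>x. \<bar>exp x\<bar> *\<^sub>R ?f (exp x)"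
  have eq: "?g = (\<lambda>x. exp (s * of_real x - of_real (exp x)))"
  proof
    fix x :: real
    have "complex_of_real (exp x) powr (s - 1) = exp ((s - 1) * of_real x)"
      by (simp add: powr_def Ln_of_real)
    then show "?g x = exp (s * of_real x - of_real (exp x))"
      by (simp add: scaleR_conv_of_real exp_diff exp_of_real[symmetric] ring_distribs)
  qed
  have "?f absolutely_integrable_on range exp \<and> integral (range exp) ?f = Gamma s"
    using absolutely_integrable_Gamma_integral'[OF s] Gamma_integral_complex'[OF s]
    by (simp add: range_exp_real integral_unique)
  then have g: "?g absolutely_integrable_on UNIV \<and> integral UNIV ?g = Gamma s"
    by (subst has_absolute_integral_change_of_variables_real[where g = exp])
       (auto intro!: derivative_eq_intros inj_onI)
  have [measurable]: "?g \<in> borel_measurable borel"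
    unfolding eq by measurable
  from g have int: "integrable lborel ?g"
    by (simp add: set_integrable_def integrable_completion)
  then have "integral\<^sup>L lborel ?g = Gamma s"
    using g integral_lborel[OF int] by simp
  with int show "integrable lborel (\<lambda>x. exp (s * of_real x - of_real (exp x)))"
    "(LINT x|lborel. exp (s * of_real x - of_real (exp x))) = Gamma s"
    unfolding eq by auto
qed

text \<open>
  The two integrands are integrable together, and both integrals are \<open>0\<close> by convention when they are
  not. So the rule applies to the Hankel form before its convergence is known.
\<close>

lemma lborel_integral_exp_substitution:
  fixes f :: "real \<Rightarrow> complex"
  assumes meas: "set_borel_measurable lborel {0<..} f"
  shows "(LINT t:{0<..}|lborel. f t) = (LINT x|lborel. exp x *\<^sub>R f (exp x))"
proof -
  let ?g = "\<lambda>x. \<bar>exp x\<bar> *\<^sub>R f (exp x)"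
  define h where "h = (\<lambda>t. indicator {0<..} t *\<^sub>R f t)"
  have [measurable]: "h \<in> borel_measurable borel"
    using meas by (simp add: set_borel_measurable_def h_def)
  have "?g = (\<lambda>x. \<bar>exp x\<bar> *\<^sub>R h (exp x))"
    by (simp add: h_def)
  also have "\<dots> \<in> borel_measurable borel"
    by measurable
  finally have g_meas: "?g \<in> borel_measurable borel" .
  have sub: "(?g absolutely_integrable_on UNIV \<and> integral UNIV ?g = b) \<longleftrightarrow>
      (f absolutely_integrable_on {0<..} \<and> integral {0<..} f = b)" for b
    unfolding range_exp_real[symmetric]
    by (rule has_absolute_integral_change_of_variables_real)
       (auto intro!: derivative_eq_intros inj_onI)
  have f_iff: "f absolutely_integrable_on {0<..} \<longleftrightarrow> set_integrable lborel {0<..} f"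
    using \<open>h \<in> borel_measurable borel\<close> unfolding h_def
    by (simp add: set_integrable_def integrable_completion)
  have g_iff: "?g absolutely_integrable_on UNIV \<longleftrightarrow> integrable lborel ?g"
    using g_meas by (simp add: set_integrable_def integrable_completion)
  show ?thesis
  proof (cases "integrable lborel ?g")
    case True
    then have "set_integrable lborel {0<..} f"
      using sub f_iff g_iff by blast
    with True show ?thesis
      using sub[of "integral UNIV ?g"] f_iff g_iff set_borel_integral_eq_integral(2)[of "{0<..}" f]
        integral_lborel[OF True] by simp
  next
    case False
    then have "\<not> set_integrable lborel {0<..} f"
      using sub f_iff g_iff by blast
    with False show ?thesis
      by (simp add: set_lebesgue_integral_def set_integrable_def not_integrable_integral_eq)
  qed
qed

section \<open>The Fourier transform\<close>
text \<open>
  The shear \<open>(x, y) \<mapsto> (x, y - s x)\<close> preserves Lebesgue measure, so the majorant is as integrable as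
  a product of functions of one variable. The case \<open>s = 0\<close> covers plain products and \<open>s = 1\<close>
  convolutions.
\<close>

lemma integrable_pair_dominated:
  fixes f :: "real \<times> real \<Rightarrow> complex" and A B :: "real \<Rightarrow> real"
  assumes f: "f \<in> borel_measurable (lborel \<Otimes>\<^sub>M lborel)"
    and A: "integrable lborel A" and B: "integrable lborel B"
    and le: "\<And>x y. norm (f (x, y)) \<le> A x * B (y - s * x)"
  shows "integrable (lborel \<Otimes>\<^sub>M lborel) f"
proof -
  have [measurable]: "A \<in> borel_measurable borel" "B \<in> borel_measurable borel"
    using A B by auto
  have B': "integrable lborel (\<lambda>y. B (y - s * x))"
       "(LINT y|lborel. B (y - s * x)) = integral\<^sup>L lborel B" for x
    using lborel_integrable_real_affine[OF B, of 1 "- s * x"]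
      lborel_integral_real_affine[of 1 B "- s * x"] by (simp_all add: algebra_simps)
  have "integrable (lborel \<Otimes>\<^sub>M lborel) (\<lambda>(x, y). A x * B (y - s * x))"
  proof (rule lborel_pair.Fubini_integrable)
    show "(\<lambda>(x, y). A x * B (y - s * x)) \<in> borel_measurable (lborel \<Otimes>\<^sub>M lborel)"
      by measurable
    have "(LINT y|lborel. norm (A x * B (y - s * x))) = norm (A x) * (LINT y|lborel. norm (B y))" for x
      using lborel_integral_real_affine[of 1 "\<lambda>y. norm (B y)" "- s * x"]
      by (simp add: abs_mult algebra_simps)
    then show "integrable lborel (\<lambda>x. LINT y|lborel. norm (case (x, y) of (x, y) \<Rightarrow> A x * B (y - s * x)))"
      using A by simp
    show "AE x in lborel. integrable lborel (\<lambda>y. case (x, y) of (x, y) \<Rightarrow> A x * B (y - s * x))"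
      using B'(1) by simp
  qed
  then show ?thesis
    by (rule Bochner_Integration.integrable_bound)
       (use f le in \<open>auto intro!: AE_I2 order_trans[OF _ abs_ge_self]\<close>)
qed

lemma norm_phase [simp]: "cmod (exp (- \<i> * of_real x * of_real \<xi>)) = 1"
  by (simp add: norm_exp_eq_Re)

lemma norm_phase_pos [simp]: "cmod (exp (\<i> * of_real x * of_real \<xi>)) = 1"
  by (simp add: norm_exp_eq_Re)

lemma integrable_mult_bounded:
  fixes a b :: "real \<Rightarrow> complex"
  assumes a: "integrable lborel a" and [measurable]: "b \<in> borel_measurable borel"
    and b: "\<And>x. cmod (b x) \<le> C"
  shows "integrable lborel (\<lambda>x. a x * b x)"
proof (rule Bochner_Integration.integrable_bound)
  have [measurable]: "a \<in> borel_measurable borel"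
    using a by auto
  show "integrable lborel (\<lambda>x. C * cmod (a x))"
    using a by simp
  show "(\<lambda>x. a x * b x) \<in> borel_measurable lborel"
    by measurable
  have "cmod (a x * b x) \<le> norm (C * cmod (a x))" for x
    using mult_left_mono[OF b[of x] norm_ge_zero[of "a x"]] order_trans[OF norm_ge_zero b[of x]]
    by (simp add: norm_mult mult.commute)
  then show "AE x in lborel. norm (a x * b x) \<le> norm (C * cmod (a x))"
    by simp
qed

lemma integrable_mult_phase:
  assumes "integrable lborel a"
  shows "integrable lborel (\<lambda>x. a x * exp (- \<i> * of_real x * of_real \<xi>))"
  by (rule integrable_mult_bounded[OF assms, where C = 1]) auto

lemma fourier_measurable [measurable]:
  assumes "integrable lborel a"
  shows "fourier a \<in> borel_measurable borel"
proof -
  have [measurable]: "a \<in> borel_measurable borel"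
    using assms by auto
  show ?thesis
    unfolding fourier_def[abs_def] by measurable
qed

lemma fourier_bounded:
  assumes "integrable lborel a"
  shows "cmod (fourier a \<xi>) \<le> (2 * pi) powr (- 1 / 2) * (LINT x|lborel. cmod (a x))"
proof -
  have "cmod (LINT x|lborel. a x * exp (- \<i> * of_real x * of_real \<xi>))
      \<le> (LINT x|lborel. cmod (a x * exp (- \<i> * of_real x * of_real \<xi>)))"
    by (rule integral_norm_bound)
  then show ?thesis
    by (simp add: fourier_def norm_mult)
qed

text \<open>
  Both sides are the double integral of \<open>a x * b \<xi> * exp (-i x \<xi>)\<close>, which converges absolutely.
\<close>

lemma fourier_mult_formula:
  assumes a: "integrable lborel a" and b: "integrable lborel b"
  shows "(LINT \<xi>|lborel. fourier a \<xi> * b \<xi>) = (LINT x|lborel. a x * fourier b x)"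
proof -
  let ?c = "complex_of_real ((2 * pi) powr (- 1 / 2))"
  let ?f = "\<lambda>x \<xi>. a x * b \<xi> * exp (- \<i> * of_real x * of_real \<xi>)"
  have [measurable]: "a \<in> borel_measurable borel" "b \<in> borel_measurable borel"
    using a b by auto
  have int: "integrable (lborel \<Otimes>\<^sub>M lborel) (\<lambda>(x, \<xi>). ?f x \<xi>)"
  proof (rule integrable_pair_dominated)
    show "(\<lambda>(x, \<xi>). ?f x \<xi>) \<in> borel_measurable (lborel \<Otimes>\<^sub>M lborel)"
      by measurable
    show "integrable lborel (\<lambda>x. cmod (a x))" "integrable lborel (\<lambda>x. cmod (b x))"
      using a b by auto
    show "norm (case (x, \<xi>) of (x, \<xi>) \<Rightarrow> ?f x \<xi>) \<le> cmod (a x) * cmod (b (\<xi> - 0 * x))" for x \<xi>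
      by (simp add: norm_mult)
  qed
  have "(LINT \<xi>|lborel. fourier a \<xi> * b \<xi>) = ?c * (LINT \<xi>|lborel. LINT x|lborel. ?f x \<xi>)"
    by (simp add: fourier_def mult.assoc mult.commute mult.left_commute
        flip: integral_mult_right_zero integral_mult_left_zero)
  also have "(LINT \<xi>|lborel. LINT x|lborel. ?f x \<xi>) = (LINT x|lborel. LINT \<xi>|lborel. ?f x \<xi>)"
    by (rule lborel_pair.Fubini_integral[OF int])
  also have "?c * \<dots> = (LINT x|lborel. a x * fourier b x)"
    by (simp add: fourier_def mult.assoc mult.commute mult.left_commute
        flip: integral_mult_right_zero integral_mult_left_zero)
  finally show ?thesis .
qed

text \<open>
  This is the characteristic function of the standard normal distribution.
\<close>

lemma fourier_gaussian:
  "(LINT t|lborel. of_real (exp (- t\<^sup>2 / 2)) * exp (- \<i> * of_real t * of_real y)) =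
     complex_of_real (sqrt (2 * pi) * exp (- y\<^sup>2 / 2))"
proof -
  have "of_real (exp (- (- y)\<^sup>2 / 2)) = char std_normal_distribution (- y)"
    by (simp add: char_std_normal_distribution)
  also have "\<dots> = (LINT t|lborel. std_normal_density t *\<^sub>R exp (\<i> * of_real (- y * t)))"
    unfolding char_def by (subst integral_density) auto
  also have "\<dots> = (LINT t|lborel. of_real (1 / sqrt (2 * pi)) *
      (of_real (exp (- t\<^sup>2 / 2)) * exp (- \<i> * of_real t * of_real y)))"
    by (simp add: std_normal_density_def scaleR_conv_of_real mult.assoc mult.commute mult.left_commute)
  also have "\<dots> = of_real (1 / sqrt (2 * pi)) *
      (LINT t|lborel. of_real (exp (- t\<^sup>2 / 2)) * exp (- \<i> * of_real t * of_real y))"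
    by simp
  finally show ?thesis
    by (simp add: field_simps)
qed

lemma integrable_gaussian: "integrable lborel (\<lambda>t::real. exp (- t\<^sup>2 / 2))"
proof -
  have "integrable lborel (\<lambda>t. sqrt (2 * pi) * std_normal_density t)"
    by simp
  then show ?thesis
    by (simp add: std_normal_density_def)
qed

lemma fourier_constant_sq: "(2 * pi) powr (- 1 / 2) * sqrt (2 * pi) = 1"
  by (simp add: powr_minus powr_half_sqrt[symmetric] flip: powr_add)

text \<open>
  Insert the Gaussian cutoff \<open>exp (-(\<epsilon> \<xi>)\<^sup>2 / 2)\<close> into the inverse transform. The multiplication
  formula moves the Fourier transform onto the cutoff, where it becomes a Gaussian of width \<open>\<epsilon>\<close>
  centred at \<open>x\<close>; rescaling gives the average of \<open>a (x + \<epsilon> s)\<close> over a fixed Gaussian, which tends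
  to \<open>a x\<close> because \<open>a\<close> is bounded and continuous. On the other side the cutoff disappears by
  dominated convergence.
\<close>

theorem fourier_inversion:
  assumes a: "integrable lborel a" and cont: "continuous_on UNIV a"
    and bound: "\<And>x. cmod (a x) \<le> C" and fa: "integrable lborel (fourier a)"
  shows "of_real ((2 * pi) powr (- 1 / 2)) *
           (LINT \<xi>|lborel. fourier a \<xi> * exp (\<i> * of_real x * of_real \<xi>)) = a x"
proof -
  let ?c = "complex_of_real ((2 * pi) powr (- 1 / 2))"
  let ?G = "\<lambda>t::real. exp (- t\<^sup>2 / 2)"
  have [measurable]: "a \<in> borel_measurable borel" "fourier a \<in> borel_measurable borel"
    using a fa by auto
  \<comment> \<open>The widths \<open>\<epsilon>\<close> of the argument above.\<close>
  define e where "e n = inverse (real (Suc n))" for n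
  have e: "e n > 0" for n by (simp add: e_def)
  have e_lim: "e \<longlonglongrightarrow> 0"
    unfolding e_def by (rule LIMSEQ_inverse_real_of_nat)
  define g where "g n \<xi> = of_real (?G (e n * \<xi>)) * exp (\<i> * of_real x * of_real \<xi>)" for n \<xi>
  have g_int: "integrable lborel (g n)" for n
    unfolding g_def
  proof (rule integrable_mult_bounded[where C = 1])
    show "integrable lborel (\<lambda>\<xi>. complex_of_real (?G (e n * \<xi>)))"
      using lborel_integrable_real_affine[OF integrable_gaussian, of "e n" 0] e[of n]
      by (intro integrable_of_real) simp
  qed auto
  have g_fourier: "fourier (g n) y = of_real (?G ((y - x) / e n) / e n)" for n y
  proof -
    have "(LINT \<xi>|lborel. g n \<xi> * exp (- \<i> * of_real \<xi> * of_real y)) =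
        (1 / e n) *\<^sub>R (LINT t|lborel. g n (t / e n) * exp (- \<i> * of_real (t / e n) * of_real y))"
      using e[of n] by (subst lborel_integral_real_affine[of "1 / e n" _ 0]) auto
    also have "(\<lambda>t. g n (t / e n) * exp (- \<i> * of_real (t / e n) * of_real y)) =
        (\<lambda>t. of_real (?G t) * exp (- \<i> * of_real t * of_real ((y - x) / e n)))"
      using e[of n] by (auto simp: g_def fun_eq_iff mult.assoc diff_divide_distrib algebra_simps simp flip: exp_add)
    also have "(LINT t|lborel. \<dots> t) = of_real (sqrt (2 * pi) * ?G ((y - x) / e n))"
      by (rule fourier_gaussian)
    finally have "fourier (g n) y =
        of_real (((2 * pi) powr (- 1 / 2) * sqrt (2 * pi)) * (?G ((y - x) / e n) / e n))"
      by (simp add: fourier_def scaleR_conv_of_real)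
    then show ?thesis
      by (simp only: fourier_constant_sq mult_1)
  qed
  have approx: "(LINT \<xi>|lborel. fourier a \<xi> * g n \<xi>) = (LINT s|lborel. a (x + e n * s) * of_real (?G s))" for n
  proof -
    have "(LINT \<xi>|lborel. fourier a \<xi> * g n \<xi>) = (LINT y|lborel. a y * of_real (?G ((y - x) / e n) / e n))"
      by (simp add: fourier_mult_formula[OF a g_int] g_fourier)
    also have "\<dots> = e n *\<^sub>R (LINT s|lborel. a (x + e n * s) * of_real (?G s / e n))"
      using e[of n] by (subst lborel_integral_real_affine[of "e n" _ x]) auto
    also have "\<dots> = (LINT s|lborel. a (x + e n * s) * of_real (?G s))"
      using e[of n] by (subst integral_scaleR_right[symmetric]) (auto simp: scaleR_conv_of_real)
    finally show ?thesis .
  qed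
  have "(\<lambda>n. LINT \<xi>|lborel. fourier a \<xi> * g n \<xi>)
      \<longlonglongrightarrow> (LINT \<xi>|lborel. fourier a \<xi> * exp (\<i> * of_real x * of_real \<xi>))"
  proof (rule integral_dominated_convergence[where w = "\<lambda>\<xi>. cmod (fourier a \<xi>)"])
    show "AE \<xi> in lborel. (\<lambda>n. fourier a \<xi> * g n \<xi>)
        \<longlonglongrightarrow> fourier a \<xi> * exp (\<i> * of_real x * of_real \<xi>)"
    proof (rule AE_I2)
      fix \<xi>
      have "(\<lambda>n. fourier a \<xi> * g n \<xi>)
          \<longlonglongrightarrow> fourier a \<xi> * (of_real (?G (0 * \<xi>)) * exp (\<i> * of_real x * of_real \<xi>))"
        unfolding g_def by (intro tendsto_intros e_lim) auto
      then show "(\<lambda>n. fourier a \<xi> * g n \<xi>) \<longlonglongrightarrow> fourier a \<xi> * exp (\<i> * of_real x * of_real \<xi>)"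
        by simp
    qed
    show "AE \<xi> in lborel. cmod (fourier a \<xi> * g n \<xi>) \<le> cmod (fourier a \<xi>)" for n
      by (auto simp: g_def norm_mult intro!: mult_right_le_one_le)
    show "integrable lborel (\<lambda>\<xi>. cmod (fourier a \<xi>))"
      using fa by simp
    show "(\<lambda>\<xi>. fourier a \<xi> * g n \<xi>) \<in> borel_measurable lborel" for n
      unfolding g_def by measurable
  qed measurable
  moreover have "(\<lambda>n. LINT s|lborel. a (x + e n * s) * of_real (?G s))
      \<longlonglongrightarrow> (LINT s|lborel. a x * of_real (?G s))"
  proof (rule integral_dominated_convergence[where w = "\<lambda>s. C * ?G s"])
    show "AE s in lborel. (\<lambda>n. a (x + e n * s) * of_real (?G s)) \<longlonglongrightarrow> a x * of_real (?G s)"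
    proof (rule AE_I2)
      fix s
      have "(\<lambda>n. x + e n * s) \<longlonglongrightarrow> x + 0 * s"
        by (intro tendsto_intros e_lim)
      moreover have "isCont a x"
        using cont by (simp add: continuous_on_eq_continuous_at)
      ultimately have "(\<lambda>n. a (x + e n * s)) \<longlonglongrightarrow> a x"
        by (intro isCont_tendsto_compose[of x a]) simp_all
      then show "(\<lambda>n. a (x + e n * s) * of_real (?G s)) \<longlonglongrightarrow> a x * of_real (?G s)"
        by (intro tendsto_intros)
    qed
    show "integrable lborel (\<lambda>s. C * ?G s)"
      by (intro integrable_mult_right integrable_gaussian)
    show "AE s in lborel. cmod (a (x + e n * s) * of_real (?G s)) \<le> C * ?G s" for n
      by (intro AE_I2) (auto simp: norm_mult intro!: mult_right_mono bound)
  qed measurable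
  ultimately have "(LINT \<xi>|lborel. fourier a \<xi> * exp (\<i> * of_real x * of_real \<xi>))
      = (LINT s|lborel. a x * of_real (?G s))"
    unfolding approx by (rule LIMSEQ_unique)
  also have "\<dots> = a x * of_real (sqrt (2 * pi))"
    using fourier_gaussian[of 0] by simp
  finally have "?c * (LINT \<xi>|lborel. fourier a \<xi> * exp (\<i> * of_real x * of_real \<xi>))
      = a x * of_real ((2 * pi) powr (- 1 / 2) * sqrt (2 * pi))"
    by simp
  then show ?thesis
    by (simp only: fourier_constant_sq) simp
qed

text \<open>
  Apply the multiplication formula to \<open>a\<close> and \<open>cnj (fourier b)\<close>: by inversion the Fourier transform
  of the latter is \<open>cnj b\<close>. All regularity is put on \<open>b\<close>, because in the application \<open>a\<close> carries the
  polynomial factor.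
\<close>

corollary parseval:
  assumes a: "integrable lborel a"
    and b: "integrable lborel b" "continuous_on UNIV b" "\<And>x. cmod (b x) \<le> C"
      "integrable lborel (fourier b)"
  shows "(LINT \<xi>|lborel. fourier a \<xi> * cnj (fourier b \<xi>)) = (LINT x|lborel. a x * cnj (b x))"
proof -
  have "fourier (\<lambda>\<xi>. cnj (fourier b \<xi>)) x = cnj (b x)" for x
  proof -
    have "fourier (\<lambda>\<xi>. cnj (fourier b \<xi>)) x = of_real ((2 * pi) powr (- 1 / 2)) *
        (LINT \<xi>|lborel. cnj (fourier b \<xi> * exp (\<i> * of_real x * of_real \<xi>)))"
      by (simp add: fourier_def exp_cnj mult.commute mult.left_commute)
    also have "\<dots> = cnj (of_real ((2 * pi) powr (- 1 / 2)) *
        (LINT \<xi>|lborel. fourier b \<xi> * exp (\<i> * of_real x * of_real \<xi>)))"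
      by (subst Bochner_Integration.integral_cnj) simp
    also have "\<dots> = cnj (b x)"
      by (simp only: fourier_inversion[OF b])
    finally show ?thesis .
  qed
  moreover have "integrable lborel (\<lambda>\<xi>. cnj (fourier b \<xi>))"
    using b(4) by simp
  ultimately show ?thesis
    by (simp add: fourier_mult_formula[OF a])
qed

lemma norm_phase_diff_le:
  "cmod (exp (- \<i> * of_real x * of_real \<eta>) - exp (- \<i> * of_real x * of_real \<xi>)) \<le> \<bar>x\<bar> * \<bar>\<eta> - \<xi>\<bar>"
proof -
  have "exp (- \<i> * of_real x * of_real \<eta>) =
      exp (- \<i> * of_real x * of_real \<xi>) * exp (\<i> * of_real (- x * (\<eta> - \<xi>)))"
    by (simp add: algebra_simps flip: exp_add)
  then have "exp (- \<i> * of_real x * of_real \<eta>) - exp (- \<i> * of_real x * of_real \<xi>) =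
      exp (- \<i> * of_real x * of_real \<xi>) * (exp (\<i> * of_real (- x * (\<eta> - \<xi>))) - 1)"
    by (simp add: algebra_simps)
  moreover have "cmod (exp (\<i> * of_real (- x * (\<eta> - \<xi>))) - 1) \<le> \<bar>x\<bar> * \<bar>\<eta> - \<xi>\<bar>"
    using iexp_approx1[of "- x * (\<eta> - \<xi>)" 0] by (simp add: abs_mult)
  ultimately show ?thesis
    by (simp add: norm_mult)
qed

text \<open>
  Differentiation under the integral sign. The first-order Taylor remainder \<open>r\<close> of the phase, divided
  by the increment, is at most \<open>2 \<bar>x\<bar>\<close>, so \<open>2 \<bar>x a(x)\<bar>\<close> dominates.
\<close>

lemma has_vector_derivative_fourier:
  assumes a: "integrable lborel a" and xa: "integrable lborel (\<lambda>x. of_real x * a x)"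
  shows "(fourier a has_vector_derivative - \<i> * fourier (\<lambda>x. of_real x * a x) \<xi>) (at \<xi>)"
proof -
  let ?c = "complex_of_real ((2 * pi) powr (- 1 / 2))"
  let ?e = "\<lambda>x \<eta>. exp (- \<i> * of_real x * of_real \<eta>)"
  define r where "r \<eta> x = ?e x \<eta> - ?e x \<xi> - (\<eta> - \<xi>) *\<^sub>R (- \<i> * of_real x * ?e x \<xi>)" for \<eta> x
  have [measurable]: "a \<in> borel_measurable borel"
    using a by auto
  have r_meas [measurable]: "r \<eta> \<in> borel_measurable borel" for \<eta>
    unfolding r_def[abs_def] by measurable
  have r_le: "cmod (r \<eta> x) \<le> 2 * \<bar>x\<bar> * \<bar>\<eta> - \<xi>\<bar>" for \<eta> x
  proof -
    have "cmod (r \<eta> x) \<le> cmod (?e x \<eta> - ?e x \<xi>) + cmod ((\<eta> - \<xi>) *\<^sub>R (- \<i> * of_real x * ?e x \<xi>))"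
      unfolding r_def by (rule norm_triangle_ineq4)
    also have "\<dots> \<le> \<bar>x\<bar> * \<bar>\<eta> - \<xi>\<bar> + \<bar>\<eta> - \<xi>\<bar> * \<bar>x\<bar>"
      by (intro add_mono norm_phase_diff_le) (simp add: norm_mult)
    finally show ?thesis by simp
  qed
  have r_lim: "((\<lambda>\<eta>. r \<eta> x /\<^sub>R norm (\<eta> - \<xi>)) \<longlongrightarrow> 0) (at \<xi>)" for x
  proof -
    have "((\<lambda>\<eta>. ?e x \<eta>) has_vector_derivative (- \<i> * of_real x * ?e x \<xi>)) (at \<xi>)"
      by (rule has_vector_derivative_real_field) (auto intro!: derivative_eq_intros)
    then show ?thesis
      by (simp add: has_vector_derivative_def has_derivative_at_within r_def)
  qed
  have remainder: "fourier a \<eta> - fourier a \<xi> - (\<eta> - \<xi>) *\<^sub>R (- \<i> * fourier (\<lambda>x. of_real x * a x) \<xi>)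
      = ?c * (LINT x|lborel. a x * r \<eta> x)" for \<eta>
  proof -
    have "(LINT x|lborel. a x * r \<eta> x) = (LINT x|lborel. a x * ?e x \<eta> - a x * ?e x \<xi>
        - (\<eta> - \<xi>) *\<^sub>R (- \<i> * (of_real x * a x * ?e x \<xi>)))"
      by (intro Bochner_Integration.integral_cong) (simp_all add: r_def algebra_simps)
    also have "\<dots> = (LINT x|lborel. a x * ?e x \<eta>) - (LINT x|lborel. a x * ?e x \<xi>)
        - (\<eta> - \<xi>) *\<^sub>R (- \<i> * (LINT x|lborel. of_real x * a x * ?e x \<xi>))"
      using integrable_mult_phase[OF a] integrable_mult_phase[OF xa] by simp
    finally show ?thesis
      unfolding fourier_def by (simp only:) (simp add: algebra_simps scaleR_conv_of_real)
  qed
  have "((\<lambda>\<eta>. (LINT x|lborel. a x * r \<eta> x) /\<^sub>R norm (\<eta> - \<xi>)) \<longlongrightarrow> 0) (at \<xi>)"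
  proof (unfold tendsto_at_iff_sequentially, intro allI impI)
    fix X :: "nat \<Rightarrow> real"
    assume X: "\<forall>i. X i \<in> UNIV - {\<xi>}" "X \<longlonglongrightarrow> \<xi>"
    have "(\<lambda>n. LINT x|lborel. a x * (r (X n) x /\<^sub>R norm (X n - \<xi>))) \<longlonglongrightarrow> (LINT x::real|lborel. (0 :: complex))"
    proof (rule integral_dominated_convergence[where w = "\<lambda>x. 2 * cmod (of_real x * a x)"])
      show "AE x in lborel. (\<lambda>n. a x * (r (X n) x /\<^sub>R norm (X n - \<xi>))) \<longlonglongrightarrow> 0"
      proof (rule AE_I2)
        fix x
        have "(\<lambda>n. r (X n) x /\<^sub>R norm (X n - \<xi>)) \<longlonglongrightarrow> 0"
          using r_lim[of x] X unfolding tendsto_at_iff_sequentially by (auto simp: o_def)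
        then show "(\<lambda>n. a x * (r (X n) x /\<^sub>R norm (X n - \<xi>))) \<longlonglongrightarrow> 0"
          by (intro tendsto_mult_right_zero)
      qed
      show "integrable lborel (\<lambda>x. 2 * cmod (of_real x * a x))"
        using xa by auto
      show "AE x in lborel. cmod (a x * (r (X n) x /\<^sub>R norm (X n - \<xi>))) \<le> 2 * cmod (of_real x * a x)" for n
      proof (rule AE_I2)
        fix x
        have "X n \<noteq> \<xi>" using X(1) by auto
        then have "cmod (r (X n) x) / \<bar>X n - \<xi>\<bar> \<le> 2 * \<bar>x\<bar>"
          using r_le[of "X n" x] by (simp add: divide_le_eq)
        from mult_left_mono[OF this norm_ge_zero[of "a x"]]
        show "cmod (a x * (r (X n) x /\<^sub>R norm (X n - \<xi>))) \<le> 2 * cmod (of_real x * a x)"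
          by (simp add: norm_mult divide_inverse mult_ac)
      qed
    qed measurable
    then show "((\<lambda>\<eta>. (LINT x|lborel. a x * r \<eta> x) /\<^sub>R norm (\<eta> - \<xi>)) \<circ> X) \<longlonglongrightarrow> 0"
      by (simp add: o_def)
  qed
  from tendsto_mult_right_zero[OF this, of ?c]
  have "((\<lambda>\<eta>. (fourier a \<eta> - fourier a \<xi> - (\<eta> - \<xi>) *\<^sub>R (- \<i> * fourier (\<lambda>x. of_real x * a x) \<xi>))
      /\<^sub>R norm (\<eta> - \<xi>)) \<longlongrightarrow> 0) (at \<xi>)"
    unfolding remainder by simp
  then show ?thesis
    unfolding has_vector_derivative_def has_derivative_at_within
    by (intro conjI bounded_linear_scaleR_left)
qed

text \<open>
  The sign in \<open>D = i d/d\<xi>\<close> is the one that turns \<open>D\<close> into multiplication by \<open>x\<close> without a factor.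
\<close>

lemma D_op_funpow_fourier:
  assumes "\<And>n. integrable lborel (\<lambda>x. of_real x ^ n * a x)"
  shows "(D_op ^^ k) (fourier a) = fourier (\<lambda>x. of_real x ^ k * a x)"
proof (induction k)
  case (Suc k)
  have "D_op (fourier (\<lambda>x. of_real x ^ k * a x)) \<xi> = fourier (\<lambda>x. of_real x ^ Suc k * a x) \<xi>" for \<xi>
    using has_vector_derivative_fourier[of "\<lambda>x. of_real x ^ k * a x" \<xi>] assms[of k] assms[of "Suc k"]
    by (simp add: D_op_def vderiv_def vector_derivative_at mult.assoc flip: mult.assoc[of \<i> \<i>])
  then show ?case
    using Suc by auto
qed simp

lemma fourier_poly_mult:
  assumes "\<And>n. integrable lborel (\<lambda>x. of_real x ^ n * a x)"
  shows "fourier (\<lambda>x. poly Q (of_real x) * a x) \<xi> =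
           (\<Sum>k\<le>degree Q. coeff Q k * fourier (\<lambda>x. of_real x ^ k * a x) \<xi>)"
proof -
  have "(LINT x|lborel. poly Q (of_real x) * a x * exp (- \<i> * of_real x * of_real \<xi>)) =
      (LINT x|lborel. (\<Sum>k\<le>degree Q. coeff Q k * (of_real x ^ k * a x * exp (- \<i> * of_real x * of_real \<xi>))))"
    by (simp add: poly_altdef sum_distrib_left sum_distrib_right mult_ac)
  also have "\<dots> = (\<Sum>k\<le>degree Q. coeff Q k *
      (LINT x|lborel. of_real x ^ k * a x * exp (- \<i> * of_real x * of_real \<xi>)))"
    using integrable_mult_phase[OF assms] by (subst Bochner_Integration.integral_sum) auto
  finally show ?thesis
    by (simp add: fourier_def sum_distrib_left mult_ac)
qed

lemma poly_D_fourier: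
  assumes "\<And>n. integrable lborel (\<lambda>x. of_real x ^ n * a x)"
  shows "poly_D Q (fourier a) = fourier (\<lambda>x. poly Q (of_real x) * a x)"
  by (simp add: fun_eq_iff poly_D_def D_op_funpow_fourier[OF assms] fourier_poly_mult[OF assms]
      atMost_atLeast0)

section \<open>The kernel as a Laplace transform\<close>
text \<open>
  Along \<open>s = -i \<xi>\<close> the operator \<open>i d/d\<xi>\<close> is the complex derivative \<open>d/ds\<close>. This turns statements
  about real Fourier integrals into statements about derivatives of holomorphic functions.
\<close>

lemma D_op_funpow_holomorphic:
  assumes G: "G holomorphic_on S" "open S" and S: "\<And>\<xi>. - \<i> * of_real \<xi> \<in> S"
  shows "(D_op ^^ k) (\<lambda>\<xi>. G (- \<i> * of_real \<xi>)) = (\<lambda>\<xi>. (deriv ^^ k) G (- \<i> * of_real \<xi>))"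
proof (induction k)
  case (Suc k)
  have dv: "((\<lambda>\<xi>. (deriv ^^ k) G (- \<i> * of_real \<xi>)) has_vector_derivative
      - \<i> * (deriv ^^ Suc k) G (- \<i> * of_real \<xi>)) (at \<xi>)" for \<xi>
  proof (rule has_vector_derivative_real_field)
    have "((deriv ^^ k) G has_field_derivative (deriv ^^ Suc k) G (- \<i> * of_real \<xi>)) (at (- \<i> * of_real \<xi>))"
      using holomorphic_derivI[OF holomorphic_higher_deriv[OF G] G(2) S] by simp
    moreover have "((\<lambda>z. - \<i> * z) has_field_derivative - \<i>) (at (of_real \<xi>))"
      by (auto intro!: derivative_eq_intros)
    ultimately have "((\<lambda>z. (deriv ^^ k) G (- \<i> * z)) has_field_derivative
        (deriv ^^ Suc k) G (- \<i> * of_real \<xi>) * - \<i>) (at (of_real \<xi>))"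
      by (rule DERIV_chain2)
    then show "((\<lambda>z. (deriv ^^ k) G (- \<i> * z)) has_field_derivative
        - \<i> * (deriv ^^ Suc k) G (- \<i> * of_real \<xi>)) (at (of_real \<xi>))"
      by (simp only: mult.commute)
  qed
  then have "D_op (\<lambda>\<xi>. (deriv ^^ k) G (- \<i> * of_real \<xi>)) \<xi> = (deriv ^^ Suc k) G (- \<i> * of_real \<xi>)" for \<xi>
    unfolding D_op_def vderiv_def vector_derivative_at[OF dv] by (simp flip: mult.assoc)
  then show ?case
    by (intro ext) (simp only: funpow.simps o_apply Suc)
qed simp

lemma higher_deriv_exp_affine:
  fixes c d :: complex
  shows "(deriv ^^ n) (\<lambda>s. exp (c * s + d)) = (\<lambda>s. c ^ n * exp (c * s + d))"
proof (induction n)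
  case (Suc n)
  have "deriv (\<lambda>s. c ^ n * exp (c * s + d)) s = c ^ Suc n * exp (c * s + d)" for s
    by (rule DERIV_imp_deriv) (auto intro!: derivative_eq_intros)
  then show ?case
    by (simp add: Suc fun_eq_iff)
qed simp

text \<open>
  This is \<open>\<Gamma>(1 - s) \<tau>\<^bsup>s - 1\<^esup>\<close>, the integral of \<open>\<lambda>\<^bsup>-s\<^esup> e\<^bsup>-\<tau> \<lambda>\<^esup>\<close> over \<open>\<lambda> > 0\<close>. The power is written with an
  affine exponent so that its derivatives can be read off.
\<close>

definition mellin_exp :: "real \<Rightarrow> complex \<Rightarrow> complex" where
  "mellin_exp \<tau> s = Gamma (1 - s) * exp (of_real (ln \<tau>) * s + of_real (- ln \<tau>))"

lemma mellin_exp_holomorphic: "mellin_exp \<tau> holomorphic_on {s. Re s < 1}"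
proof -
  have "1 - s \<notin> \<int>\<^sub>\<le>\<^sub>0" if "Re s < 1" for s :: complex
    using that by (auto elim!: nonpos_Ints_cases simp: complex_eq_iff)
  then have "(\<lambda>s. Gamma (1 - s)) holomorphic_on {s. Re s < 1}"
    by (intro holomorphic_intros) auto
  then show ?thesis
    unfolding mellin_exp_def[abs_def]
    by (rule holomorphic_on_mult) (intro holomorphic_intros)
qed

lemma open_Re_less_1: "open {s. Re s < 1}"
  by (rule open_halfspace_Re_lt)

lemma omega_holomorphic: "omega holomorphic_on S"
proof -
  have "omega = (\<lambda>z. rGamma (1 - z))"
    by (simp add: omega_def rGamma_inverse_Gamma fun_eq_iff)
  moreover have "(\<lambda>z. rGamma (1 - z)) holomorphic_on S"
    by (intro holomorphic_intros)
  ultimately show ?thesis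
    by (simp only:)
qed

text \<open>
  The factor \<open>\<omega>(s) = 1 / \<Gamma>(1 - s)\<close> cancels the Gamma function in \<open>mellin_exp\<close> and leaves
  \<open>\<tau>\<^bsup>s - 1\<^esup>\<close>. The sum is Leibniz' rule for the \<open>l\<close>-th derivative of this product at \<open>s = 0\<close>. This
  identity is the reason for the definition of the coefficients of \<open>Q\<close>.
\<close>

lemma higher_deriv_mellin_exp_omega:
  assumes "\<tau> > 0"
  shows "(\<Sum>k\<le>l. of_nat (l choose k) * (deriv ^^ (l - k)) omega 0 * (deriv ^^ k) (mellin_exp \<tau>) 0)
           = of_real (ln \<tau>) ^ l / of_real \<tau>"
proof -
  let ?S = "{s. Re s < 1}"
  let ?E = "\<lambda>s. exp (complex_of_real (ln \<tau>) * s + of_real (- ln \<tau>))"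
  have "(\<Sum>k\<le>l. of_nat (l choose k) * (deriv ^^ (l - k)) omega 0 * (deriv ^^ k) (mellin_exp \<tau>) 0)
      = (deriv ^^ l) (\<lambda>s. mellin_exp \<tau> s * omega s) 0"
    by (subst higher_deriv_mult[OF mellin_exp_holomorphic omega_holomorphic open_Re_less_1])
       (simp_all add: atMost_atLeast0 mult_ac)
  also have "\<dots> = (deriv ^^ l) ?E 0"
  proof (rule higher_deriv_transform_within_open[OF _ _ open_Re_less_1])
    show "(\<lambda>s. mellin_exp \<tau> s * omega s) holomorphic_on ?S"
      by (intro holomorphic_intros mellin_exp_holomorphic omega_holomorphic)
    show "?E holomorphic_on ?S"
      by (intro holomorphic_intros)
    show "mellin_exp \<tau> s * omega s = ?E s" if "s \<in> ?S" for s
    proof -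
      have "1 - s \<notin> \<int>\<^sub>\<le>\<^sub>0"
        using that by (auto elim!: nonpos_Ints_cases simp: complex_eq_iff)
      then have "Gamma (1 - s) \<noteq> 0"
        by (simp add: Gamma_eq_zero_iff)
      then show ?thesis
        by (simp add: mellin_exp_def omega_def)
    qed
  qed simp
  also have "\<dots> = of_real (ln \<tau>) ^ l / of_real \<tau>"
    unfolding higher_deriv_exp_affine using assms by (simp add: exp_minus exp_of_real divide_inverse)
  finally show ?thesis .
qed

text \<open>
  With \<open>\<lambda> = e\<^bsup>-z\<^esup>\<close> the left-hand side is the integral of \<open>(- ln \<lambda>)\<^sup>k e\<^bsup>-\<tau> \<lambda>\<^esup>\<close>, that is, the \<open>k\<close>-th derivative at
  \<open>s = 0\<close> of the integral of \<open>\<lambda>\<^bsup>-s\<^esup> e\<^bsup>-\<tau> \<lambda>\<^esup>\<close>. The proof takes the derivatives along the imaginary axis,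
  where they are powers of \<open>D\<close> on a Fourier transform.
\<close>

lemma double_exp_moments:
  assumes \<tau>: "\<tau> > 0"
  shows "(LINT z|lborel. of_real z ^ k * of_real (exp (- z - \<tau> * exp (- z)))) = (deriv ^^ k) (mellin_exp \<tau>) 0"
proof -
  let ?c = "complex_of_real ((2 * pi) powr (- 1 / 2))"
  let ?m = "\<lambda>z. complex_of_real (exp (- z - \<tau> * exp (- z)))"
  let ?G = "\<lambda>s. ?c * mellin_exp \<tau> s"
  have "fourier ?m \<xi> = ?G (- \<i> * of_real \<xi>)" for \<xi>
  proof -
    have eq: "?m (ln \<tau> - x) * exp (- \<i> * of_real (ln \<tau> - x) * of_real \<xi>) =
        exp ((1 + \<i> * of_real \<xi>) * of_real x - of_real (exp x)) *
        exp (of_real (ln \<tau>) * (- \<i> * of_real \<xi>) + of_real (- ln \<tau>))" for x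
    proof -
      have "?m (ln \<tau> - x) = exp (of_real (x - ln \<tau>) - of_real (exp x))"
      proof -
        have "- (ln \<tau> - x) - \<tau> * exp (- (ln \<tau> - x)) = x - ln \<tau> - exp x"
          using \<tau> by (simp add: exp_diff)
        then show ?thesis
          by (simp only:) (simp flip: exp_of_real)
      qed
      then show ?thesis
        by (simp add: algebra_simps flip: exp_add)
    qed
    have "(LINT z|lborel. ?m z * exp (- \<i> * of_real z * of_real \<xi>)) =
        (LINT x|lborel. ?m (ln \<tau> - x) * exp (- \<i> * of_real (ln \<tau> - x) * of_real \<xi>))"
      by (subst lborel_integral_real_affine[of "-1" _ "ln \<tau>"]) simp_all
    also have "\<dots> = Gamma (1 + \<i> * of_real \<xi>) *
        exp (of_real (ln \<tau>) * (- \<i> * of_real \<xi>) + of_real (- ln \<tau>))"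
      unfolding eq using Gamma_exp_integral(2)[of "1 + \<i> * of_real \<xi>"] by simp
    finally show ?thesis
      by (simp add: fourier_def mellin_exp_def)
  qed
  then have fm: "fourier ?m = (\<lambda>\<xi>. ?G (- \<i> * of_real \<xi>))"
    by blast
  have "(D_op ^^ k) (fourier ?m) = (\<lambda>\<xi>. (deriv ^^ k) ?G (- \<i> * of_real \<xi>))"
    unfolding fm
    by (rule D_op_funpow_holomorphic[OF _ open_Re_less_1])
       (auto intro!: holomorphic_intros mellin_exp_holomorphic)
  then have "fourier (\<lambda>z. of_real z ^ k * ?m z) 0 = (deriv ^^ k) ?G 0"
    by (simp add: D_op_funpow_fourier[OF rapidly_decreasing_moment_integrable[OF rapidly_decreasing_double_exp[OF \<tau>]]])
  also have "\<dots> = ?c * (deriv ^^ k) (mellin_exp \<tau>) 0"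
    by (rule higher_deriv_cmult[OF mellin_exp_holomorphic _ open_Re_less_1]) simp
  finally have "?c * (LINT z|lborel. of_real z ^ k * ?m z) = ?c * (deriv ^^ k) (mellin_exp \<tau>) 0"
    by (simp add: fourier_def)
  moreover have "?c \<noteq> 0"
    using pi_gt_zero by simp
  ultimately show ?thesis
    by (simp only: mult_cancel_left simp_thms)
qed

lemma poly_Q_poly: "poly (Q_poly P) x = (\<Sum>k\<le>degree P. Q_coeff P k * x ^ k)"
  by (simp add: Q_poly_def poly_sum poly_monom atMost_atLeast0)

text \<open>
  The kernel \<open>P(ln \<tau>) / \<tau>\<close> is the Laplace transform of \<open>Q(- ln \<lambda>)\<close>, in the variable \<open>\<lambda> = e\<^bsup>-z\<^esup>\<close>: after
  an interchange of two finite sums, the coefficient of each \<open>p\<^sub>l\<close> is the Leibniz sum computed above.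
\<close>

theorem log_kernel_laplace:
  assumes \<tau>: "\<tau> > 0"
  shows "(LINT z|lborel. poly (Q_poly P) (of_real z) * of_real (exp (- z - \<tau> * exp (- z)))) = log_kernel P \<tau>"
proof -
  let ?m = "\<lambda>z. complex_of_real (exp (- z - \<tau> * exp (- z)))"
  let ?n = "degree P"
  let ?M = "\<lambda>k. (deriv ^^ k) (mellin_exp \<tau>) 0"
  have int: "integrable lborel (\<lambda>z. of_real z ^ k * ?m z)" for k
    by (rule rapidly_decreasing_moment_integrable[OF rapidly_decreasing_double_exp[OF \<tau>]])
  have "(LINT z|lborel. poly (Q_poly P) (of_real z) * ?m z) =
      (LINT z|lborel. (\<Sum>k\<le>?n. Q_coeff P k * (of_real z ^ k * ?m z)))"
    by (simp add: poly_Q_poly sum_distrib_right mult.assoc)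
  also have "\<dots> = (\<Sum>k\<le>?n. Q_coeff P k * ?M k)"
    using int by (subst Bochner_Integration.integral_sum) (auto simp: double_exp_moments[OF \<tau>])
  also have "\<dots> = (\<Sum>k\<le>?n. \<Sum>l | l \<in> {..?n} \<and> k \<le> l.
      of_nat (l choose k) * (deriv ^^ (l - k)) omega 0 * coeff P l * ?M k)"
    by (auto simp: Q_coeff_def sum_distrib_right intro!: sum.cong)
  also have "\<dots> = (\<Sum>l\<le>?n. \<Sum>k | k \<in> {..?n} \<and> k \<le> l.
      of_nat (l choose k) * (deriv ^^ (l - k)) omega 0 * coeff P l * ?M k)"
    by (rule sum.swap_restrict) auto
  also have "\<dots> = (\<Sum>l\<le>?n. coeff P l *
      (\<Sum>k\<le>l. of_nat (l choose k) * (deriv ^^ (l - k)) omega 0 * ?M k))"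
    unfolding sum_distrib_left by (intro sum.cong) (auto simp: mult_ac)
  also have "\<dots> = (\<Sum>l\<le>?n. coeff P l * (of_real (ln \<tau>) ^ l / of_real \<tau>))"
    by (simp only: higher_deriv_mellin_exp_omega[OF \<tau>])
  also have "\<dots> = log_kernel P \<tau>"
    by (simp add: log_kernel_def poly_altdef sum_divide_distrib)
  finally show ?thesis .
qed

section \<open>The weight on the critical line\<close>

text \<open>
  On the line \<open>Re s = 1/2\<close> conjugation is \<open>s \<mapsto> 1 - s\<close>, so the reflection formula computes \<open>\<bar>\<Gamma>(s)\<bar>\<^sup>2\<close>.
\<close>

lemma cmod_Gamma_half_line: "cmod (Gamma (1 / 2 + \<i> * of_real \<xi>)) = v_fun \<xi>"
proof -
  let ?s = "1 / 2 + \<i> * complex_of_real \<xi>"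
  have "sin (of_real pi * ?s) = cos (of_real pi * (\<i> * of_real \<xi>))"
    by (simp add: sin_add distrib_left flip: of_real_divide)
  also have "\<dots> = of_real (cosh (pi * \<xi>))"
    by (simp add: cosh_conv_cos[symmetric] cosh_field_def exp_of_real[symmetric] mult_ac)
  finally have sin: "sin (of_real pi * ?s) = of_real (cosh (pi * \<xi>))" .
  have "of_real ((cmod (Gamma ?s))\<^sup>2) = Gamma ?s * cnj (Gamma ?s)"
    by (rule complex_norm_square)
  also have "\<dots> = Gamma ?s * Gamma (1 - ?s)"
    by (simp add: cnj_Gamma)
  also have "\<dots> = of_real (pi / cosh (pi * \<xi>))"
    unfolding Gamma_reflection_complex sin by simp
  finally have "(cmod (Gamma ?s))\<^sup>2 = pi / cosh (pi * \<xi>)"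
    by (simp only: of_real_eq_iff)
  then have "cmod (Gamma ?s) = sqrt (pi / cosh (pi * \<xi>))"
    by (metis norm_ge_zero real_sqrt_abs abs_of_nonneg)
  then show ?thesis
    by (simp add: v_fun_def real_sqrt_divide)
qed

lemma rapidly_decreasing_v_fun: "rapidly_decreasing (\<lambda>\<xi>. of_real (v_fun \<xi>))"
proof (rule rapidly_decreasing_if_exp_bounded[where C = "sqrt (2 * pi)"])
  show "continuous_on UNIV (\<lambda>\<xi>. complex_of_real (v_fun \<xi>))"
    unfolding v_fun_def by (intro continuous_intros) auto
  fix \<xi> :: real
  have v_nonneg: "v_fun \<xi> \<ge> 0"
    by (simp add: v_fun_def)
  have "exp \<bar>\<xi>\<bar> \<le> exp \<bar>pi * \<xi>\<bar>"
    using mult_right_mono[of 1 pi "\<bar>\<xi>\<bar>"] pi_gt3 by (simp add: abs_mult)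
  also have "\<dots> \<le> 2 * cosh (pi * \<xi>)"
    by (simp add: cosh_def abs_if)
  finally have "pi / cosh (pi * \<xi>) \<le> 2 * pi * exp (- \<bar>\<xi>\<bar>)"
    by (simp add: field_simps exp_minus)
  then have "v_fun \<xi> \<le> sqrt (2 * pi * exp (- \<bar>\<xi>\<bar>))"
    by (simp add: v_fun_def flip: real_sqrt_divide)
  also have "exp (- \<bar>\<xi>\<bar>) = (exp (- \<bar>\<xi>\<bar> / 2))\<^sup>2"
    by (simp add: power2_eq_square flip: exp_add)
  finally show "cmod (of_real (v_fun \<xi>)) \<le> sqrt (2 * pi) * exp (- \<bar>\<xi>\<bar> / 2)"
    using v_nonneg by (simp add: real_sqrt_mult)
qed

section \<open>Convolution with the Gamma kernel\<close>
lemma borel_measurable_complex_cnj [measurable]: "cnj \<in> borel_measurable borel"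
  by (intro borel_measurable_continuous_onI continuous_intros)

lemma borel_measurable_poly [measurable]:
  fixes Q :: "complex poly"
  shows "poly Q \<in> borel_measurable borel"
  by (intro borel_measurable_continuous_onI continuous_intros)

text \<open>
  If \<open>u = U f\<close>, this is \<open>e\<^bsup>-z/2\<^esup>\<close> times the Laplace transform of \<open>f\<close> at \<open>e\<^bsup>-z\<^esup>\<close>.
\<close>

definition gamma_conv :: "(real \<Rightarrow> complex) \<Rightarrow> real \<Rightarrow> complex" where
  "gamma_conv u z = (LINT x|lborel. of_real (gamma_kernel (x - z)) * u x)"

text \<open>
  The weight splits as \<open>\<bar>z\<bar> \<le> (1 + \<bar>x\<bar>) (1 + \<bar>z - x\<bar>)\<close>: one factor is absorbed by \<open>u\<close>, the other by the
  kernel.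
\<close>

lemma gamma_conv_pair_integrable:
  assumes "rapidly_decreasing u"
  shows "integrable (lborel \<Otimes>\<^sub>M lborel)
           (\<lambda>(x, z). of_real z ^ n * (of_real (gamma_kernel (x - z)) * u x))"
proof (rule integrable_pair_dominated[where s = 1])
  have [measurable]: "u \<in> borel_measurable borel"
    by (rule rapidly_decreasing_measurable[OF assms])
  show "(\<lambda>(x, z). of_real z ^ n * (of_real (gamma_kernel (x - z)) * u x))
      \<in> borel_measurable (lborel \<Otimes>\<^sub>M lborel)"
    by measurable
  show "integrable lborel (\<lambda>x. (1 + \<bar>x\<bar>) ^ n * cmod (u x))"
    by (rule rapidly_decreasing_weight_integrable[OF assms])
  show "integrable lborel (\<lambda>y. (1 + \<bar>y\<bar>) ^ n * gamma_kernel (- y))"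
    using lborel_integrable_real_affine[OF
        rapidly_decreasing_weight_integrable[OF rapidly_decreasing_gamma_kernel, of n], of "- 1" 0]
    by (simp add: abs_of_pos[OF gamma_kernel_pos])
  fix x z :: real
  have "\<bar>z\<bar> ^ n \<le> ((1 + \<bar>x\<bar>) * (1 + \<bar>z - x\<bar>)) ^ n"
  proof (rule power_mono)
    have "(1 + \<bar>x\<bar>) * (1 + \<bar>z - x\<bar>) = 1 + \<bar>x\<bar> + \<bar>z - x\<bar> + \<bar>x\<bar> * \<bar>z - x\<bar>"
      by (simp add: algebra_simps)
    moreover have "0 \<le> \<bar>x\<bar> * \<bar>z - x\<bar>"
      by simp
    ultimately show "\<bar>z\<bar> \<le> (1 + \<bar>x\<bar>) * (1 + \<bar>z - x\<bar>)"
      by linarith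
  qed simp
  then have "\<bar>z\<bar> ^ n * (gamma_kernel (x - z) * cmod (u x)) \<le>
      ((1 + \<bar>x\<bar>) * (1 + \<bar>z - x\<bar>)) ^ n * (gamma_kernel (x - z) * cmod (u x))"
    using gamma_kernel_pos[of "x - z"] by (intro mult_right_mono) auto
  then show "norm (case (x, z) of (x, z) \<Rightarrow> of_real z ^ n * (of_real (gamma_kernel (x - z)) * u x))
      \<le> (1 + \<bar>x\<bar>) ^ n * cmod (u x) * ((1 + \<bar>z - 1 * x\<bar>) ^ n * gamma_kernel (- (z - 1 * x)))"
    using gamma_kernel_pos[of "x - z"]
    by (simp add: norm_mult norm_power power_mult_distrib mult_ac)
qed

lemma gamma_conv_moment_integrable:
  assumes "rapidly_decreasing u"
  shows "integrable lborel (\<lambda>z. of_real z ^ n * gamma_conv u z)"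
  using lborel_pair.integrable_snd[OF gamma_conv_pair_integrable[OF assms, of n]]
  by (simp add: gamma_conv_def)

lemma gamma_conv_integrable:
  "rapidly_decreasing u \<Longrightarrow> integrable lborel (gamma_conv u)"
  using gamma_conv_moment_integrable[of u 0] by simp

lemma gamma_conv_poly_integrable:
  assumes u: "rapidly_decreasing u"
  shows "integrable lborel (\<lambda>z. poly Q (of_real z) * gamma_conv u z)"
proof -
  have "integrable lborel (\<lambda>z. \<Sum>k\<le>degree Q. coeff Q k * (of_real z ^ k * gamma_conv u z))"
    by (intro Bochner_Integration.integrable_sum integrable_mult_right gamma_conv_moment_integrable[OF u])
  then show ?thesis
    by (simp add: poly_altdef sum_distrib_right mult.assoc)
qed

lemma gamma_kernel_shift_mult_integrable:
  fixes u :: "real \<Rightarrow> complex"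
  assumes "integrable lborel u"
  shows "integrable lborel (\<lambda>x. of_real (gamma_kernel (x - z)) * u x)"
  using integrable_mult_bounded[OF assms, of "\<lambda>x. of_real (gamma_kernel (x - z))" 1]
    gamma_kernel_le_1 gamma_kernel_pos
  by (simp add: mult.commute abs_of_pos)

lemma gamma_conv_bounded:
  assumes u: "integrable lborel u"
  shows "cmod (gamma_conv u z) \<le> (LINT x|lborel. cmod (u x))"
proof -
  have "cmod (gamma_conv u z) \<le> (LINT x|lborel. cmod (of_real (gamma_kernel (x - z)) * u x))"
    unfolding gamma_conv_def by (rule integral_norm_bound)
  also have "\<dots> \<le> (LINT x|lborel. cmod (u x))"
  proof (rule integral_mono)
    show "integrable lborel (\<lambda>x. cmod (of_real (gamma_kernel (x - z)) * u x))"
      by (rule integrable_norm[OF gamma_kernel_shift_mult_integrable[OF u]])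
    show "cmod (of_real (gamma_kernel (x - z)) * u x) \<le> cmod (u x)" for x
      using gamma_kernel_le_1[of "x - z"] gamma_kernel_pos[of "x - z"]
      by (simp add: norm_mult mult_left_le_one_le)
  qed (use u in simp)
  finally show ?thesis .
qed

lemma continuous_on_gamma_conv:
  assumes u: "integrable lborel u"
  shows "continuous_on UNIV (gamma_conv u)"
proof (rule continuous_at_imp_continuous_on, intro ballI)
  fix z :: real
  have [measurable]: "u \<in> borel_measurable borel" using u by auto
  have cont: "isCont gamma_kernel y" for y
    using continuous_on_gamma_kernel[OF continuous_on_id, of UNIV]
    by (simp add: continuous_on_eq_continuous_at)
  show "isCont (gamma_conv u) z"
  proof (unfold continuous_at_sequentially, intro allI impI)
    fix X :: "nat \<Rightarrow> real" assume X: "X \<longlonglongrightarrow> z"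
    have "(\<lambda>n. LINT x|lborel. of_real (gamma_kernel (x - X n)) * u x)
        \<longlonglongrightarrow> (LINT x|lborel. of_real (gamma_kernel (x - z)) * u x)"
    proof (rule integral_dominated_convergence[where w = "\<lambda>x. cmod (u x)"])
      show "AE x in lborel. (\<lambda>n. of_real (gamma_kernel (x - X n)) * u x)
          \<longlonglongrightarrow> of_real (gamma_kernel (x - z)) * u x"
        by (intro AE_I2 tendsto_intros isCont_tendsto_compose[OF cont] X)
      show "AE x in lborel. cmod (of_real (gamma_kernel (x - X n)) * u x) \<le> cmod (u x)" for n
        using gamma_kernel_le_1 less_imp_le[OF gamma_kernel_pos]
        by (intro AE_I2) (simp add: norm_mult mult_left_le_one_le)
    qed (use u in simp_all)
    then show "(gamma_conv u \<circ> X) \<longlonglongrightarrow> gamma_conv u z"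
      by (simp add: gamma_conv_def o_def)
  qed
qed

text \<open>
  The convolution theorem: the Fourier integral of the reflected kernel is Euler's integral for
  \<open>\<Gamma>(1/2 + i \<xi>)\<close>.
\<close>

lemma fourier_gamma_conv:
  assumes u: "rapidly_decreasing u"
  shows "fourier (gamma_conv u) \<xi> = Gamma (1 / 2 + \<i> * of_real \<xi>) * fourier u \<xi>"
proof -
  let ?e = "\<lambda>x. exp (- \<i> * of_real x * of_real \<xi>)"
  let ?G = "Gamma (1 / 2 + \<i> * of_real \<xi>)"
  let ?f = "\<lambda>x z. of_real (gamma_kernel (x - z)) * u x * ?e z"
  have [measurable]: "u \<in> borel_measurable borel"
    by (rule rapidly_decreasing_measurable[OF u])
  have "integrable (lborel \<Otimes>\<^sub>M lborel) (case_prod ?f)"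
  proof (rule Bochner_Integration.integrable_bound[OF gamma_conv_pair_integrable[OF u, of 0]])
    show "case_prod ?f \<in> borel_measurable (lborel \<Otimes>\<^sub>M lborel)"
      by measurable
    show "AE p in lborel \<Otimes>\<^sub>M lborel. norm (case_prod ?f p)
        \<le> norm (case p of (x, z) \<Rightarrow> of_real z ^ 0 * (of_real (gamma_kernel (x - z)) * u x))"
      by (auto simp: norm_mult)
  qed
  then have swap: "(LINT z|lborel. LINT x|lborel. ?f x z) = (LINT x|lborel. LINT z|lborel. ?f x z)"
    by (rule lborel_pair.Fubini_integral)
  have inner: "(LINT z|lborel. ?f x z) = ?G * (u x * ?e x)" for x
  proof -
    have eq: "?f x (x - y) = u x * ?e x * exp ((1 / 2 + \<i> * of_real \<xi>) * of_real y - of_real (exp y))" for y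
    proof -
      have "complex_of_real (gamma_kernel y) = exp (of_real y / 2 - of_real (exp y))"
        unfolding gamma_kernel_def by (simp flip: exp_of_real)
      moreover have "?e (x - y) = ?e x * exp (\<i> * of_real \<xi> * of_real y)"
        by (simp add: algebra_simps flip: exp_add)
      ultimately have "?f x (x - y) = u x * ?e x *
          (exp (of_real y / 2 - of_real (exp y)) * exp (\<i> * of_real \<xi> * of_real y))"
        by (simp add: mult_ac)
      also have "exp (of_real y / 2 - of_real (exp y)) * exp (\<i> * of_real \<xi> * of_real y) =
          exp ((1 / 2 + \<i> * of_real \<xi>) * of_real y - of_real (exp y))"
        by (simp add: algebra_simps flip: exp_add)
      finally show ?thesis .
    qed
    have "(LINT z|lborel. ?f x z) = (LINT y|lborel. ?f x (x - y))"
      by (subst lborel_integral_real_affine[of "-1" _ x]) simp_all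
    also have "\<dots> = u x * ?e x * ?G"
      unfolding eq using Gamma_exp_integral(2)[of "1 / 2 + \<i> * of_real \<xi>"] by simp
    finally show ?thesis by (simp only: mult.commute)
  qed
  have "(LINT z|lborel. gamma_conv u z * ?e z) = (LINT z|lborel. LINT x|lborel. ?f x z)"
    by (simp add: gamma_conv_def)
  also have "\<dots> = ?G * (LINT x|lborel. u x * ?e x)"
    unfolding swap inner by simp
  finally show ?thesis
    by (simp add: fourier_def)
qed

text \<open>
  The Fourier transform of \<open>u\<close> is bounded, and the Gamma factor alone provides the decay.
\<close>

lemma integrable_fourier_gamma_conv:
  assumes u: "rapidly_decreasing u"
  shows "integrable lborel (fourier (gamma_conv u))"
proof (rule Bochner_Integration.integrable_bound)
  note int = rapidly_decreasing_integrable[OF u]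
  let ?C = "(2 * pi) powr (- 1 / 2) * (LINT x|lborel. cmod (u x))"
  show "integrable lborel (\<lambda>\<xi>. of_real (v_fun \<xi>) * complex_of_real ?C)"
    by (intro integrable_mult_left rapidly_decreasing_integrable[OF rapidly_decreasing_v_fun])
  show "fourier (gamma_conv u) \<in> borel_measurable lborel"
    using fourier_measurable[OF gamma_conv_integrable[OF u]] by simp
  have "cmod (fourier (gamma_conv u) \<xi>) \<le> norm (of_real (v_fun \<xi>) * complex_of_real ?C)" for \<xi>
  proof -
    have "cmod (fourier (gamma_conv u) \<xi>) = v_fun \<xi> * cmod (fourier u \<xi>)"
      by (simp add: fourier_gamma_conv[OF u] norm_mult cmod_Gamma_half_line)
    also have "\<dots> \<le> v_fun \<xi> * ?C"
      by (intro mult_left_mono fourier_bounded int) (simp add: v_fun_def)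
    finally show ?thesis
      unfolding of_real_mult[symmetric] norm_of_real by (rule order_trans[OF _ abs_ge_self])
  qed
  then show "AE \<xi> in lborel. norm (fourier (gamma_conv u) \<xi>) \<le> norm (of_real (v_fun \<xi>) * complex_of_real ?C)"
    by simp
qed

section \<open>The Hankel form\<close>

text \<open>
  In exponential coordinates the two Gamma kernels multiply to the integrand of the Laplace
  representation at \<open>\<tau> = e\<^sup>x + e\<^sup>y\<close>. So \<open>z\<close> separates the variables \<open>x\<close> and \<open>y\<close> of the Hankel kernel.
\<close>

lemma hankel_kernel_factorization:
  "(LINT z|lborel. poly (Q_poly P) (of_real z) * of_real (gamma_kernel (x - z) * gamma_kernel (y - z)))
     = of_real (exp (x / 2) * exp (y / 2)) * log_kernel P (exp x + exp y)"
proof -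
  let ?\<tau> = "exp x + exp y"
  have "gamma_kernel (x - z) * gamma_kernel (y - z) =
      exp (x / 2) * exp (y / 2) * exp (- z - ?\<tau> * exp (- z))" for z
  proof -
    have "(x - z) / 2 - exp (x - z) + ((y - z) / 2 - exp (y - z)) =
        x / 2 + y / 2 + (- z - ?\<tau> * exp (- z))"
      by (simp add: exp_diff exp_minus field_simps)
    then show ?thesis
      by (simp add: gamma_kernel_def flip: exp_add)
  qed
  then have "(LINT z|lborel. poly (Q_poly P) (of_real z) * of_real (gamma_kernel (x - z) * gamma_kernel (y - z)))
      = (LINT z|lborel. of_real (exp (x / 2) * exp (y / 2)) *
          (poly (Q_poly P) (of_real z) * of_real (exp (- z - ?\<tau> * exp (- z)))))"
    by (simp only: of_real_mult mult_ac)
  also have "\<dots> = of_real (exp (x / 2) * exp (y / 2)) * log_kernel P ?\<tau>"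
    using log_kernel_laplace[of ?\<tau> P] by (simp add: add_pos_pos)
  finally show ?thesis .
qed

lemma gamma_conv_poly_pair_integrable:
  assumes u: "rapidly_decreasing u"
  shows "integrable (lborel \<Otimes>\<^sub>M lborel)
    (\<lambda>(x, z). poly Q (of_real z) * of_real (gamma_kernel (x - z) * gamma_kernel (y - z)) * u x)"
proof (rule Bochner_Integration.integrable_bound)
  have [measurable]: "u \<in> borel_measurable borel"
    by (rule rapidly_decreasing_measurable[OF u])
  let ?b = "\<lambda>(x, z). \<Sum>k\<le>degree Q. coeff Q k * (of_real z ^ k * (of_real (gamma_kernel (x - z)) * u x))"
  have "integrable (lborel \<Otimes>\<^sub>M lborel) (\<lambda>p. \<Sum>k\<le>degree Q. coeff Q k *
      (case p of (x, z) \<Rightarrow> of_real z ^ k * (of_real (gamma_kernel (x - z)) * u x)))"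
    by (intro Bochner_Integration.integrable_sum integrable_mult_right gamma_conv_pair_integrable[OF u])
  then show "integrable (lborel \<Otimes>\<^sub>M lborel) ?b"
    by (simp add: case_prod_unfold)
  show "(\<lambda>(x, z). poly Q (of_real z) * of_real (gamma_kernel (x - z) * gamma_kernel (y - z)) * u x)
      \<in> borel_measurable (lborel \<Otimes>\<^sub>M lborel)"
    by measurable
  have "norm (poly Q (of_real z) * of_real (gamma_kernel (x - z) * gamma_kernel (y - z)) * u x)
      \<le> norm (?b (x, z))" for x z
  proof -
    have b: "?b (x, z) = poly Q (of_real z) * of_real (gamma_kernel (x - z)) * u x"
      by (simp add: poly_altdef sum_distrib_right mult.assoc)
    have "norm (poly Q (of_real z) * of_real (gamma_kernel (x - z) * gamma_kernel (y - z)) * u x)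
        = gamma_kernel (y - z) * norm (?b (x, z))"
      unfolding b using gamma_kernel_pos[of "y - z"] by (simp add: norm_mult)
    also have "\<dots> \<le> norm (?b (x, z))"
      using gamma_kernel_pos[of "y - z"] by (intro mult_left_le_one_le gamma_kernel_le_1) auto
    finally show ?thesis .
  qed
  then show "AE p in lborel \<Otimes>\<^sub>M lborel.
      norm (case p of (x, z) \<Rightarrow> poly Q (of_real z) * of_real (gamma_kernel (x - z) * gamma_kernel (y - z)) * u x)
        \<le> norm (?b p)"
    by (intro AE_I2) auto
qed

text \<open>
  Substitute the factorized kernel and exchange integrals. The exchanges are done in the order \<open>x\<close>, \<open>y\<close>,
  since after the first one the integrand is an integrable function of \<open>z\<close> times \<open>u2\<close> times a
  kernel that is at most \<open>1\<close>.
\<close>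

lemma hankel_form_diagonal:
  assumes u1: "rapidly_decreasing u1" and u2: "rapidly_decreasing u2"
  shows "(LINT y|lborel. (LINT x|lborel.
            of_real (exp (x / 2) * exp (y / 2)) * log_kernel P (exp x + exp y) * u1 x) * cnj (u2 y))
       = (LINT z|lborel. poly (Q_poly P) (of_real z) * gamma_conv u1 z * cnj (gamma_conv u2 z))"
proof -
  let ?Q = "\<lambda>z. poly (Q_poly P) (complex_of_real z)"
  let ?a = "\<lambda>z. ?Q z * gamma_conv u1 z"
  have [measurable]: "u1 \<in> borel_measurable borel" "u2 \<in> borel_measurable borel"
    using u1 u2 by (auto intro: rapidly_decreasing_measurable)
  have a: "integrable lborel ?a"
    by (rule gamma_conv_poly_integrable[OF u1])
  have [measurable]: "gamma_conv u1 \<in> borel_measurable borel"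
    using gamma_conv_integrable[OF u1] by auto
  have inner: "(LINT x|lborel.
      of_real (exp (x / 2) * exp (y / 2)) * log_kernel P (exp x + exp y) * u1 x)
      = (LINT z|lborel. ?a z * of_real (gamma_kernel (y - z)))" for y
  proof -
    let ?g = "\<lambda>x z. ?Q z * of_real (gamma_kernel (x - z) * gamma_kernel (y - z)) * u1 x"
    have "(LINT x|lborel. of_real (exp (x / 2) * exp (y / 2)) * log_kernel P (exp x + exp y) * u1 x)
        = (LINT x|lborel. LINT z|lborel. ?g x z)"
      by (simp only: hankel_kernel_factorization[symmetric] integral_mult_left_zero)
    also have "\<dots> = (LINT z|lborel. LINT x|lborel. ?g x z)"
      by (rule lborel_pair.Fubini_integral[symmetric, OF gamma_conv_poly_pair_integrable[OF u1]])
    also have "\<dots> = (LINT z|lborel. LINT x|lborel.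
        (?Q z * of_real (gamma_kernel (y - z))) * (of_real (gamma_kernel (x - z)) * u1 x))"
      by (simp only: of_real_mult mult_ac)
    also have "\<dots> = (LINT z|lborel. ?a z * of_real (gamma_kernel (y - z)))"
      by (simp only: integral_mult_right_zero gamma_conv_def[symmetric]) (simp only: mult_ac)
    finally show ?thesis .
  qed
  let ?h = "\<lambda>z y. ?a z * of_real (gamma_kernel (y - z)) * cnj (u2 y)"
  have "integrable (lborel \<Otimes>\<^sub>M lborel) (case_prod ?h)"
  proof (rule integrable_pair_dominated[where s = 0])
    show "case_prod ?h \<in> borel_measurable (lborel \<Otimes>\<^sub>M lborel)"
      by measurable
    show "integrable lborel (\<lambda>z. cmod (?a z))" "integrable lborel (\<lambda>y. cmod (u2 y))"
      using a rapidly_decreasing_integrable[OF u2] by auto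
    show "norm (case_prod ?h (z, y)) \<le> cmod (?a z) * cmod (u2 (y - 0 * z))" for z y
      using mult_left_le_one_le[of "cmod (?a z) * cmod (u2 y)" "gamma_kernel (y - z)"]
        gamma_kernel_le_1[of "y - z"] gamma_kernel_pos[of "y - z"]
      by (simp add: norm_mult mult_ac)
  qed
  then have "(LINT y|lborel. LINT z|lborel. ?h z y) = (LINT z|lborel. LINT y|lborel. ?h z y)"
    by (rule lborel_pair.Fubini_integral)
  moreover have "(LINT y|lborel. ?h z y) = ?a z * cnj (gamma_conv u2 z)" for z
  proof -
    have "(LINT y|lborel. ?h z y) = (LINT y|lborel. ?a z * cnj (of_real (gamma_kernel (y - z)) * u2 y))"
      by (simp add: mult_ac)
    also have "\<dots> = ?a z * cnj (gamma_conv u2 z)"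
      by (simp only: integral_mult_right_zero Bochner_Integration.integral_cnj gamma_conv_def)
    finally show ?thesis .
  qed
  ultimately show ?thesis
    unfolding inner by (simp flip: integral_mult_left_zero)
qed

section \<open>Transport to the real line\<close>

lemma log_kernel_measurable [measurable]: "log_kernel P \<in> borel_measurable borel"
  unfolding log_kernel_def[abs_def] by measurable

lemma U_op_measurable:
  assumes "f \<in> L2 {0<..}"
  shows "U_op f \<in> borel_measurable borel"
proof -
  define g where "g = (\<lambda>t. indicator {0<..} t *\<^sub>R f t)"
  have [measurable]: "g \<in> borel_measurable borel"
    using assms by (simp add: L2_def set_borel_measurable_def g_def)
  have "U_op f = (\<lambda>x. of_real (exp (x / 2)) * g (exp x))"
    by (simp add: U_op_def g_def fun_eq_iff)
  then show ?thesis by simp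
qed

lemma hankel_exp_coordinates:
  assumes f: "f \<in> L2 {0<..}" and [measurable]: "h \<in> borel_measurable borel"
  shows "hankel h f t = (LINT x|lborel. of_real (exp (x / 2)) * h (t + exp x) * U_op f x)"
proof -
  define g where "g = (\<lambda>t. indicator {0<..} t *\<^sub>R f t)"
  have [measurable]: "g \<in> borel_measurable borel"
    using f by (simp add: L2_def set_borel_measurable_def g_def)
  have "(\<lambda>s. indicator {0<..} s *\<^sub>R (h (t + s) * f s)) = (\<lambda>s. h (t + s) * g s)"
    by (simp add: g_def fun_eq_iff)
  then have "set_borel_measurable lborel {0<..} (\<lambda>s. h (t + s) * f s)"
    by (simp add: set_borel_measurable_def)
  then have "hankel h f t = (LINT x|lborel. exp x *\<^sub>R (h (t + exp x) * f (exp x)))"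
    unfolding hankel_def by (rule lborel_integral_exp_substitution)
  also have "\<dots> = (LINT x|lborel. of_real (exp (x / 2)) * h (t + exp x) * U_op f x)"
  proof (rule Bochner_Integration.integral_cong[OF refl])
    fix x :: real
    have "exp x = exp (x / 2) * exp (x / 2)" by (simp flip: exp_add)
    then have e: "complex_of_real (exp x) = of_real (exp (x / 2)) * of_real (exp (x / 2))"
      by (simp only: of_real_mult)
    show "exp x *\<^sub>R (h (t + exp x) * f (exp x)) = of_real (exp (x / 2)) * h (t + exp x) * U_op f x"
      unfolding scaleR_conv_of_real e U_op_def by (simp only: mult_ac)
  qed
  finally show ?thesis .
qed

lemma L2_inner_exp_coordinates:
  assumes f: "f \<in> L2 {0<..}" and g: "set_borel_measurable lborel {0<..} g"
  shows "L2_inner {0<..} g f = (LINT y|lborel. U_op g y * cnj (U_op f y))"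
proof -
  define f' where "f' = (\<lambda>t. indicator {0<..} t *\<^sub>R f t)"
  define g' where "g' = (\<lambda>t. indicator {0<..} t *\<^sub>R g t)"
  have [measurable]: "f' \<in> borel_measurable borel" "g' \<in> borel_measurable borel"
    using f g by (simp_all add: L2_def set_borel_measurable_def f'_def g'_def)
  have "(\<lambda>t. indicator {0<..} t *\<^sub>R (g t * cnj (f t))) = (\<lambda>t. g' t * cnj (f' t))"
    by (auto simp: fun_eq_iff indicator_def f'_def g'_def)
  then have "set_borel_measurable lborel {0<..} (\<lambda>t. g t * cnj (f t))"
    by (simp add: set_borel_measurable_def)
  then have "L2_inner {0<..} g f = (LINT y|lborel. exp y *\<^sub>R (g (exp y) * cnj (f (exp y))))"
    unfolding L2_inner_def by (rule lborel_integral_exp_substitution)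
  also have "\<dots> = (LINT y|lborel. U_op g y * cnj (U_op f y))"
  proof (rule Bochner_Integration.integral_cong[OF refl])
    fix y :: real
    have "exp y = exp (y / 2) * exp (y / 2)" by (simp flip: exp_add)
    then have e: "complex_of_real (exp y) = of_real (exp (y / 2)) * of_real (exp (y / 2))"
      by (simp only: of_real_mult)
    show "exp y *\<^sub>R (g (exp y) * cnj (f (exp y))) = U_op g y * cnj (U_op f y)"
      unfolding scaleR_conv_of_real e U_op_def complex_cnj_mult complex_cnj_complex_of_real
      by (simp only: mult_ac)
  qed
  finally show ?thesis .
qed

lemma hankel_measurable:
  assumes f: "f \<in> L2 {0<..}" and [measurable]: "h \<in> borel_measurable borel"
  shows "hankel h f \<in> borel_measurable borel"
proof -
  define g where "g = (\<lambda>t. indicator {0<..} t *\<^sub>R f t)"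
  have [measurable]: "g \<in> borel_measurable borel"
    using f by (simp add: L2_def set_borel_measurable_def g_def)
  have "hankel h f = (\<lambda>t. LINT s|lborel. h (t + s) * g s)"
    by (simp add: hankel_def set_lebesgue_integral_def g_def fun_eq_iff)
  also have "\<dots> \<in> borel_measurable borel"
    by measurable
  finally show ?thesis .
qed

text \<open>
  Since \<open>v\<close> is the modulus of \<open>\<Gamma>(1/2 + i \<xi>)\<close>, multiplication by \<open>v\<close> replaces the phase in \<open>F\<close> by the full
  Gamma factor.
\<close>

lemma v_mult_F_op:
  assumes f: "f \<in> L2 {0<..}" and u: "rapidly_decreasing u" and ae: "AE x in lborel. U_op f x = u x"
  shows "of_real (v_fun \<xi>) * F_op f \<xi> = fourier (gamma_conv u) \<xi>"
proof -
  have [measurable]: "U_op f \<in> borel_measurable borel" "u \<in> borel_measurable borel"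
    using U_op_measurable[OF f] rapidly_decreasing_measurable[OF u] by auto
  have "(LINT x|lborel. U_op f x * exp (- \<i> * of_real x * of_real \<xi>)) =
      (LINT x|lborel. u x * exp (- \<i> * of_real x * of_real \<xi>))"
    by (rule integral_cong_AE) (use ae in auto)
  then have "mellin f \<xi> = fourier u \<xi>"
    by (simp add: mellin_def fourier_def)
  moreover have "v_fun \<xi> \<noteq> 0"
    by (simp add: v_fun_def)
  ultimately show ?thesis
    by (simp add: F_op_def cmod_Gamma_half_line fourier_gamma_conv[OF u])
qed

theorem theorem3p2:
  fixes P :: "complex poly" and f1 f2 :: "real \<Rightarrow> complex"
  assumes "P \<noteq> 0"
    and "f1 \<in> D_set" and "f2 \<in> D_set"
  shows "L2_inner {0<..} (hankel (log_kernel P) f1) f2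
       = L2_inner UNIV (A_op (Q_poly P) (F_op f1)) (F_op f2)"
proof -
  let ?Q = "Q_poly P"
  obtain u1 where f1: "f1 \<in> L2 {0<..}" and u1: "rapidly_decreasing u1"
    and ae1: "AE x in lborel. U_op f1 x = u1 x"
    using \<open>f1 \<in> D_set\<close> Z_space_rapidly_decreasing unfolding D_set_def by blast
  obtain u2 where f2: "f2 \<in> L2 {0<..}" and u2: "rapidly_decreasing u2"
    and ae2: "AE x in lborel. U_op f2 x = u2 x"
    using \<open>f2 \<in> D_set\<close> Z_space_rapidly_decreasing unfolding D_set_def by blast
  have [measurable]: "U_op f1 \<in> borel_measurable borel" "U_op f2 \<in> borel_measurable borel"
    "u1 \<in> borel_measurable borel" "u2 \<in> borel_measurable borel"
    using U_op_measurable f1 f2 rapidly_decreasing_measurable u1 u2 by auto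
  have [measurable]: "hankel (log_kernel P) f1 \<in> borel_measurable borel"
    by (rule hankel_measurable[OF f1]) measurable
  let ?a = "\<lambda>z. poly ?Q (of_real z) * gamma_conv u1 z"
  have a: "integrable lborel ?a"
    by (rule gamma_conv_poly_integrable[OF u1])
  have U_hankel: "U_op (hankel (log_kernel P) f1) y = (LINT x|lborel.
      of_real (exp (x / 2) * exp (y / 2)) * log_kernel P (exp x + exp y) * u1 x)" for y
  proof -
    have "U_op (hankel (log_kernel P) f1) y = of_real (exp (y / 2)) *
        (LINT x|lborel. of_real (exp (x / 2)) * log_kernel P (exp y + exp x) * U_op f1 x)"
      unfolding U_op_def[of "hankel _ _"] by (simp add: hankel_exp_coordinates[OF f1])
    also have "(LINT x|lborel. of_real (exp (x / 2)) * log_kernel P (exp y + exp x) * U_op f1 x)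
        = (LINT x|lborel. of_real (exp (x / 2)) * log_kernel P (exp y + exp x) * u1 x)"
      by (rule integral_cong_AE) (use ae1 in auto)
    also have "of_real (exp (y / 2)) * \<dots> = (LINT x|lborel.
        of_real (exp (x / 2) * exp (y / 2)) * log_kernel P (exp x + exp y) * u1 x)"
      unfolding integral_mult_right_zero[symmetric] by (simp add: mult_ac add.commute)
    finally show ?thesis .
  qed
  have "L2_inner {0<..} (hankel (log_kernel P) f1) f2
      = (LINT y|lborel. U_op (hankel (log_kernel P) f1) y * cnj (U_op f2 y))"
    by (rule L2_inner_exp_coordinates[OF f2]) (simp add: set_borel_measurable_def)
  also have "\<dots> = (LINT y|lborel. U_op (hankel (log_kernel P) f1) y * cnj (u2 y))"
  proof (rule integral_cong_AE)
    have [measurable]: "U_op (hankel (log_kernel P) f1) \<in> borel_measurable borel"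
      unfolding U_op_def[abs_def] by measurable
    show "(\<lambda>y. U_op (hankel (log_kernel P) f1) y * cnj (U_op f2 y)) \<in> borel_measurable lborel"
      "(\<lambda>y. U_op (hankel (log_kernel P) f1) y * cnj (u2 y)) \<in> borel_measurable lborel"
      by measurable
    show "AE y in lborel. U_op (hankel (log_kernel P) f1) y * cnj (U_op f2 y) =
        U_op (hankel (log_kernel P) f1) y * cnj (u2 y)"
      using ae2 by eventually_elim simp
  qed
  also have "\<dots> = (LINT z|lborel. ?a z * cnj (gamma_conv u2 z))"
    unfolding U_hankel by (rule hankel_form_diagonal[OF u1 u2])
  also have "\<dots> = (LINT \<xi>|lborel. fourier ?a \<xi> * cnj (fourier (gamma_conv u2) \<xi>))"
    by (rule parseval[symmetric, OF a gamma_conv_integrable[OF u2]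
          continuous_on_gamma_conv gamma_conv_bounded integrable_fourier_gamma_conv[OF u2]])
       (rule rapidly_decreasing_integrable[OF u2])+
  also have "\<dots> = (LINT \<xi>|lborel. A_op ?Q (F_op f1) \<xi> * cnj (F_op f2 \<xi>))"
  proof (rule Bochner_Integration.integral_cong[OF refl])
    fix \<xi>
    \<comment> \<open>The outer factor \<open>v\<close> of \<open>A\<close> passes to the second argument; it is real.\<close>
    have "A_op ?Q (F_op f1) \<xi> = of_real (v_fun \<xi>) * fourier ?a \<xi>"
      by (simp add: A_op_def v_mult_F_op[OF f1 u1 ae1] poly_D_fourier[OF gamma_conv_moment_integrable[OF u1]])
    then show "fourier ?a \<xi> * cnj (fourier (gamma_conv u2) \<xi>) = A_op ?Q (F_op f1) \<xi> * cnj (F_op f2 \<xi>)"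
      by (simp add: v_mult_F_op[OF f2 u2 ae2, symmetric] mult_ac)
  qed
  also have "\<dots> = L2_inner UNIV (A_op ?Q (F_op f1)) (F_op f2)"
    by (simp add: L2_inner_def set_lebesgue_integral_def)
  finally show ?thesis .
qed

end
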